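(* Let $K$ be an algebraically closed field and let $X\subset\mathbb{P}^r$ be a nondegenerate irreducible projective variety over $K$ of codimension at least $2$, satisfying property $N_p$ for some $p\ge2$. Let $q\in\mathbb{P}^r$ be a closed point with $q\notin X$, $\pi_q:X\to\mathbb{P}^{r-1}$ the linear projection from $q$, and $X_q=\pi_q(X)$. Suppose $\Sigma_q(X)\neq\emptyset$, and let $\Lambda\subset\mathbb{P}^{r-1}$ be the linear subspace for which there are exact sequences $$0\to S_{X_q}\to E\to S_\Lambda(-1)\to0,\qquad 0\to\mathcal{O}_{X_q}\to(\pi_q)_*\mathcal{O}_X\to\mathcal{O}_\Lambda(-1)\to0.$$ Then $\Sigma_q(X)$ is a quadric in the linear subspace $\langle q,\Lambda\rangle\subset\mathbb{P}^r$. Therefore $\Lambda=\mathrm{Sing}(\pi_q)$. In particular, $\pi_q:X\to X_q$ is birational.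
   Context: For a projective variety $X\subset\mathbb{P}^r$ with homogeneous ideal $I_X$ in the homogeneous coordinate ring $R$ of $\mathbb{P}^r$, let $\cdots\to F_i\to\cdots\to F_1\to I_X\to0$ be the minimal graded free resolution, $F_i=\bigoplus_jR(-i-j)^{\beta_{i,j}}$. $X$ is projectively normal if $H^0(\mathbb{P}^r,\mathcal{O}_{\mathbb{P}^r}(j))\to H^0(X,\mathcal{O}_X(j))$ is surjective for all $j\ge1$. $X$ satisfies property $N_p$ if it is projectively normal and $\beta_{i,j}=0$ for $1\le i\le p$ and all $j\ge2$. $S$ is the homogeneous coordinate ring of $\mathbb{P}^{r-1}$, $S_{X_q}$ and $S_\Lambda$ are the homogeneous coordinate rings of $X_q,\Lambda\subset\mathbb{P}^{r-1}$, and $E=\bigoplus_{j\in\mathbb{Z}}H^0(X,\mathcal{O}_X(j))$, a graded $S$-module via $\pi_q$. The maps $S_{X_q}\to E$ and $\mathcal{O}_{X_q}\to(\pi_q)_*\mathcal{O}_X$ are the natural ones induced by $\pi_q$; the first sequence is one of graded $S$-modules. (Under the hypotheses with $\Sigma_q(X)\ne\emptyset$ such a $\Lambda$ exists.) The secant locus $\Sigma_q(X)$ is the set of all points of $X$ spanning secant lines through $q$, i.e. points $x\in X$ such that the line $\langle q,x\rangle$ meets $X$ in a scheme of length at least $2$ (tangent lines included). $\mathrm{Sing}(\pi_q)\subset X_q$ is the locus over which $\pi_q:X\to X_q$ fails to be an isomorphism, i.e. the image $\pi_q(\Sigma_q(X))$. $\Sigma_q(X)$ carries the scheme structure of the intersection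 of $X$ with the cone with vertex $q$ over $\mathrm{Sing}(\pi_q)$. $\langle q,\Lambda\rangle$ denotes the linear subspace of $\mathbb{P}^r$ spanned by $q$ and $\Lambda$ (the cone over $\Lambda$ with vertex $q$). A quadric in a linear space is a hypersurface defined by one nonzero quadratic form (possibly singular or non-reduced; in a line it is a length-$2$ scheme). *)

theory Defs
  imports
    "HOL-Analysis.Analysis"
    "HOL-Computational_Algebra.Polynomial"
    "HOL-Library.Poly_Mapping"
    "HOL-Library.Function_Algebras"
    "HOL-Library.Extended_Nat"
begin

section \<open>Polynomial rings\<close>

text \<open>
  \<open>('n, 'k) mpoly\<close> is the polynomial ring over \<open>'k\<close> whose variables are indexed by the finite
  type \<open>'n\<close>; it is the homogeneous coordinate ring of the projective space of lines in
  \<open>'k^'n\<close>, which has dimension \<open>CARD('n) - 1\<close>. Degrees are integers, so that shifts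
  by negative integers need no special treatment.
\<close>

type_synonym ('n, 'k) mpoly = "('n \<Rightarrow>\<^sub>0 nat) \<Rightarrow>\<^sub>0 'k"

definition poly_eval :: "('n::finite, 'k::field) mpoly \<Rightarrow> 'k^'n \<Rightarrow> 'k" where
  "poly_eval F v =
     (\<Sum>m\<in>Poly_Mapping.keys F. Poly_Mapping.lookup F m * (\<Prod>i\<in>UNIV. v $ i ^ Poly_Mapping.lookup m i))"

definition homogeneous :: "int \<Rightarrow> ('n::finite, 'k::field) mpoly \<Rightarrow> bool" where
  "homogeneous d F \<longleftrightarrow>
     (\<forall>m\<in>Poly_Mapping.keys F. (\<Sum>i\<in>UNIV. int (Poly_Mapping.lookup m i)) = d)"

interpretation ideal: module "(*) :: 'a::comm_ring_1 \<Rightarrow> 'a \<Rightarrow> 'a"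
  by unfold_locales (simp_all add: algebra_simps)

definition poly_scale :: "'k::field \<Rightarrow> ('n::finite, 'k) mpoly \<Rightarrow> ('n, 'k) mpoly" where
  "poly_scale c F = Poly_Mapping.single 0 c * F"

interpretation mpoly: vector_space "poly_scale :: 'k::field \<Rightarrow> ('n::finite, 'k) mpoly \<Rightarrow> _"
  by unfold_locales
    (simp_all add: poly_scale_def distrib_left distrib_right single_add mult_single single_one
      flip: mult.assoc)

definition hilbert_function :: "('n::finite, 'k::field) mpoly set \<Rightarrow> nat \<Rightarrow> nat" where
  "hilbert_function J d =
     mpoly.dim {F :: ('n, 'k) mpoly. homogeneous (int d) F} - mpoly.dim {F \<in> J. homogeneous (int d) F}"

text \<open>
  The length of the closed subscheme \<open>V(J)\<close> of projective space. If \<open>V(J)\<close> is finite,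
  then \<open>(R/J)\<^sub>d \<cong> H\<^sup>0(V(J), \<O>)\<close> for \<open>d\<close> large; if \<open>V(J)\<close> is infinite, the Hilbert function is
  unbounded and the length is infinite.
\<close>

definition scheme_length :: "('n::finite, 'k::field) mpoly set \<Rightarrow> enat" where
  "scheme_length J = liminf (\<lambda>d. enat (hilbert_function J d))"

text \<open>
  Two homogeneous ideals define the same closed subscheme of projective space if and only if
  their saturations agree.
\<close>

definition saturation :: "('n::finite, 'k::field) mpoly set \<Rightarrow> ('n, 'k) mpoly set" where
  "saturation J = {F. \<exists>d::nat. \<forall>G. homogeneous (int d) G \<longrightarrow> G * F \<in> J}"

section \<open>Projective space and its closed subsets\<close>

typedef (overloaded) ('k::field, 'n::finite) pspace =
  "{l :: ('k^'n) set. vec.subspace l \<and> vec.dim l = 1}"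
proof -
  have "axis undefined 1 \<noteq> (0 :: 'k^'n)"
    by (simp add: axis_eq_0_iff)
  then have "vec.dim (vec.span {axis undefined 1 :: 'k^'n}) = 1"
    by (simp add: vec.dim_eq_card_independent)
  then show ?thesis
    using vec.subspace_span by blast
qed

definition point :: "'k::field^'n::finite \<Rightarrow> ('k, 'n) pspace" where
  "point v = Abs_pspace (vec.span {v})"

text \<open>The affine cone always contains the origin, even over the empty set.\<close>

definition cone :: "('k::field, 'n::finite) pspace set \<Rightarrow> ('k^'n) set" where
  "cone Z = insert 0 (\<Union>p\<in>Z. Rep_pspace p)"

definition zariski :: "('k::field, 'n::finite) pspace topology" where
  "zariski = topology_generated_by
     {{p. \<exists>v\<in>Rep_pspace p. poly_eval F v \<noteq> 0} | F d. homogeneous d F \<and> 0 < d}"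

definition vanishing_ideal :: "('k::field, 'n::finite) pspace set \<Rightarrow> ('n, 'k) mpoly set" where
  "vanishing_ideal Z = {F. \<forall>v\<in>cone Z. poly_eval F v = 0}"

definition linear_subspace :: "('k::field, 'n::finite) pspace set \<Rightarrow> bool" where
  "linear_subspace Z \<longleftrightarrow> (\<exists>W. vec.subspace W \<and> Z = {p. Rep_pspace p \<subseteq> W})"

definition linear_span :: "('k::field, 'n::finite) pspace set \<Rightarrow> ('k, 'n) pspace set" where
  "linear_span Z = {p. Rep_pspace p \<subseteq> vec.span (cone Z)}"

definition irreducible_closed :: "'a topology \<Rightarrow> 'a set \<Rightarrow> bool" where
  "irreducible_closed T Z \<longleftrightarrow> closedin T Z \<and> Z \<noteq> {} \<and>
     (\<forall>A B. closedin T A \<longrightarrow> closedin T B \<longrightarrow> Z \<subseteq> A \<union> B \<longrightarrow> Z \<subseteq> A \<or> Z \<subseteq> B)"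

definition codimension :: "'a topology \<Rightarrow> 'a set \<Rightarrow> enat" where
  "codimension T Z = (SUP n\<in>{n. \<exists>C. C 0 = Z \<and> (\<forall>i\<le>n. irreducible_closed T (C i)) \<and>
                                   (\<forall>i<n. C i \<subset> C (Suc i))}. enat n)"

definition nondegenerate :: "('k::field, 'n::finite) pspace set \<Rightarrow> bool" where
  "nondegenerate X \<longleftrightarrow> (\<forall>H. linear_subspace H \<and> X \<subseteq> H \<longrightarrow> H = UNIV)"

text \<open>
  For a projective variety \<open>X\<close>, \<open>coordinate_ring X j\<close> is the degree \<open>j\<close> part of the homogeneous
  coordinate ring \<open>R/I\<^sub>X\<close>, realised as polynomial functions on the affine cone. As always below,
  functions are extended by zero outside their domain.
\<close>

definition coordinate_ring ::
    "('k::field, 'n::finite) pspace set \<Rightarrow> int \<Rightarrow> ('k^'n \<Rightarrow> 'k) set" where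
  "coordinate_ring Z j = {(\<lambda>v. if v \<in> cone Z then poly_eval F v else 0) | F. homogeneous j F}"

section \<open>Twisted structure sheaves, morphisms\<close>

text \<open>
  For locally closed \<open>Z\<close> with its reduced structure, \<open>twist_sections j Z\<close> is
  \<open>H\<^sup>0(Z, \<O>\<^sub>Z(j))\<close>: functions on the punctured cone over \<open>Z\<close> which are locally quotients
  of homogeneous polynomials whose degrees differ by \<open>j\<close>. The functions in \<open>H\<^sup>0(Z, \<O>\<^sub>Z)\<close> are
  constant on punctured lines; \<open>regular Z\<close> is the same space, as functions on \<open>Z\<close> itself.
\<close>

definition twist_sections ::
    "int \<Rightarrow> ('k::field, 'n::finite) pspace set \<Rightarrow> ('k^'n \<Rightarrow> 'k) set" where
  "twist_sections j Z = {s. (\<forall>v. v \<notin> cone Z - {0} \<longrightarrow> s v = 0) \<and>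
     (\<forall>p\<in>Z. \<exists>U F G d. openin zariski U \<and> p \<in> U \<and> homogeneous (d + j) F \<and> homogeneous d G \<and>
        (\<forall>v\<in>cone (Z \<inter> U) - {0}. poly_eval G v \<noteq> 0 \<and> s v = poly_eval F v / poly_eval G v))}"

definition regular :: "('k::field, 'n::finite) pspace set \<Rightarrow> (('k, 'n) pspace \<Rightarrow> 'k) set" where
  "regular Z = {f. (\<forall>p. p \<notin> Z \<longrightarrow> f p = 0) \<and>
                   (\<lambda>v. if v = 0 then 0 else f (point v)) \<in> twist_sections 0 Z}"

definition restr :: "'a set \<Rightarrow> ('a \<Rightarrow> 'k::zero) \<Rightarrow> 'a \<Rightarrow> 'k" where
  "restr A f = (\<lambda>x. if x \<in> A then f x else 0)"

definition restr_cone ::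
    "('k::field, 'n::finite) pspace set \<Rightarrow> ('k^'n \<Rightarrow> 'k) \<Rightarrow> ('k^'n \<Rightarrow> 'k)" where
  "restr_cone Z = restr (cone Z - {0})"

definition morphism_of_varieties :: "('k::field, 'n::finite) pspace set \<Rightarrow>
    ('k, 'm::finite) pspace set \<Rightarrow> (('k, 'n) pspace \<Rightarrow> ('k, 'm) pspace) \<Rightarrow> bool" where
  "morphism_of_varieties Y Z f \<longleftrightarrow>
     continuous_map (subtopology zariski Y) (subtopology zariski Z) f \<and>
     (\<forall>V. openin zariski V \<longrightarrow>
        (\<forall>s\<in>regular (Z \<inter> V). restr (Y \<inter> f -` V) (s \<circ> f) \<in> regular (Y \<inter> f -` V)))"

definition isomorphism_of_varieties :: "('k::field, 'n::finite) pspace set \<Rightarrow>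
    ('k, 'm::finite) pspace set \<Rightarrow> (('k, 'n) pspace \<Rightarrow> ('k, 'm) pspace) \<Rightarrow> bool" where
  "isomorphism_of_varieties Y Z f \<longleftrightarrow> morphism_of_varieties Y Z f \<and>
     (\<exists>g. morphism_of_varieties Z Y g \<and> (\<forall>y\<in>Y. g (f y) = y) \<and> (\<forall>z\<in>Z. f (g z) = z))"

definition birational_morphism :: "('k::field, 'n::finite) pspace set \<Rightarrow>
    ('k, 'm::finite) pspace set \<Rightarrow> (('k, 'n) pspace \<Rightarrow> ('k, 'm) pspace) \<Rightarrow> bool" where
  "birational_morphism Y Z f \<longleftrightarrow> morphism_of_varieties Y Z f \<and>
     (\<exists>U V. openin (subtopology zariski Y) U \<and> U \<noteq> {} \<and>
            openin (subtopology zariski Z) V \<and> V \<noteq> {} \<and> isomorphism_of_varieties U V f)"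

section \<open>Property \<open>N\<^sub>p\<close>\<close>

definition projectively_normal :: "('k::field, 'n::finite) pspace set \<Rightarrow> bool" where
  "projectively_normal X \<longleftrightarrow>
     (\<forall>j\<ge>1. restr_cone X ` twist_sections j UNIV = twist_sections j X)"

text \<open>The free module of rank \<open>b\<close> consists of sequences vanishing from index \<open>b\<close> on.\<close>

definition free_module :: "nat \<Rightarrow> (nat \<Rightarrow> 'a::zero) set" where
  "free_module b = {u. \<forall>c\<ge>b. u c = 0}"

definition matrix_map :: "nat \<Rightarrow> nat \<Rightarrow> (nat \<Rightarrow> nat \<Rightarrow> 'a::comm_ring_1) \<Rightarrow> (nat \<Rightarrow> 'a) \<Rightarrow> (nat \<Rightarrow> 'a)" where
  "matrix_map a b M u = (\<lambda>i. if i < a then (\<Sum>c<b. M i c * u c) else 0)"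

text \<open>
  The complex \<open>\<cdots> \<rightarrow> F\<^sub>2 \<rightarrow> F\<^sub>1 \<rightarrow> I \<rightarrow> 0\<close>, where \<open>F\<^sub>i\<close> has rank \<open>b i\<close> and generators of degrees
  \<open>e i c\<close>, and \<open>M i\<close> is the matrix of \<open>F\<^sub>i\<^sub>+\<^sub>1 \<rightarrow> F\<^sub>i\<close>. Index \<open>0\<close> stands for the ring itself, in which
  the image of \<open>F\<^sub>1\<close> is \<open>I\<close>. The resolution is minimal if no matrix entry between the
  \<open>F\<^sub>i\<close> with \<open>i \<ge> 1\<close> has a nonzero constant term.
\<close>

definition minimal_graded_free_resolution :: "('n::finite, 'k::field) mpoly set \<Rightarrow>
    (nat \<Rightarrow> nat) \<Rightarrow> (nat \<Rightarrow> nat \<Rightarrow> int) \<Rightarrow> (nat \<Rightarrow> nat \<Rightarrow> nat \<Rightarrow> ('n, 'k) mpoly) \<Rightarrow> bool" where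
  "minimal_graded_free_resolution I b e M \<longleftrightarrow>
     b 0 = 1 \<and> e 0 0 = 0 \<and>
     (\<forall>i. \<forall>a<b i. \<forall>c<b (Suc i). homogeneous (e (Suc i) c - e i a) (M i a c)) \<and>
     matrix_map (b 0) (b 1) (M 0) ` free_module (b 1) = {u \<in> free_module 1. u 0 \<in> I} \<and>
     (\<forall>i. matrix_map (b (Suc i)) (b (i + 2)) (M (Suc i)) ` free_module (b (i + 2)) =
          {u \<in> free_module (b (Suc i)). matrix_map (b i) (b (Suc i)) (M i) u = 0}) \<and>
     (\<forall>i\<ge>1. \<forall>a<b i. \<forall>c<b (Suc i). Poly_Mapping.lookup (M i a c) 0 = 0)"

definition betti :: "(nat \<Rightarrow> nat) \<Rightarrow> (nat \<Rightarrow> nat \<Rightarrow> int) \<Rightarrow> nat \<Rightarrow> int \<Rightarrow> nat" where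
  "betti b e i j = card {c. c < b i \<and> e i c = int i + j}"

text \<open>Minimal graded free resolutions exist and their Betti numbers are unique.\<close>

definition property_N :: "nat \<Rightarrow> ('k::field, 'n::finite) pspace set \<Rightarrow> bool" where
  "property_N p X \<longleftrightarrow> projectively_normal X \<and>
     (\<exists>b e M. minimal_graded_free_resolution (vanishing_ideal X) b e M \<and>
        (\<forall>i j. 1 \<le> i \<and> i \<le> p \<and> 2 \<le> j \<longrightarrow> betti b e i j = 0))"

section \<open>Projection from a point\<close>

text \<open>
  The linear projection from \<open>q\<close> is given by a surjective matrix whose kernel is the line
  \<open>q\<close>; it is unique up to a linear automorphism of the target. The value of \<open>proj_map L\<close> at \<open>q\<close>
  is arbitrary.
\<close>

definition linear_projection_from ::
    "('k::field, 'n::finite) pspace \<Rightarrow> 'k^'n^'m::finite \<Rightarrow> bool" where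
  "linear_projection_from q L \<longleftrightarrow> surj ((*v) L) \<and> {v. L *v v = 0} = Rep_pspace q"

definition proj_map :: "'k::field^'n::finite^'m::finite \<Rightarrow> ('k, 'n) pspace \<Rightarrow> ('k, 'm) pspace" where
  "proj_map L x = Abs_pspace ((*v) L ` Rep_pspace x)"

text \<open>The cone over \<open>Z\<close> whose vertex is the centre of the projection (the vertex included).\<close>

definition cone_over ::
    "'k::field^'n::finite^'m::finite \<Rightarrow> ('k, 'm) pspace set \<Rightarrow> ('k, 'n) pspace set" where
  "cone_over L Z = {x. (*v) L ` Rep_pspace x \<subseteq> cone Z}"

definition secant_locus ::
    "('k::field, 'n::finite) pspace \<Rightarrow> ('k, 'n) pspace set \<Rightarrow> ('k, 'n) pspace set" where
  "secant_locus q X = {x \<in> X.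
     scheme_length (ideal.span (vanishing_ideal X \<union> vanishing_ideal (linear_span {q, x}))) \<ge> 2}"

definition sing_locus ::
    "'k::field^'n::finite^'m::finite \<Rightarrow> ('k, 'n) pspace set \<Rightarrow> ('k, 'm) pspace set" where
  "sing_locus L X = {y \<in> proj_map L ` X. \<not> (\<exists>U. openin zariski U \<and> y \<in> U \<and>
     isomorphism_of_varieties (X \<inter> proj_map L -` U) (proj_map L ` X \<inter> U) (proj_map L))}"

text \<open>
  An ideal defining the scheme structure of the secant locus, namely that of the
  scheme-theoretic intersection of \<open>X\<close> with the cone over \<open>sing_locus L X\<close>.
\<close>

definition secant_scheme_ideal ::
    "'k::field^'n::finite^'m::finite \<Rightarrow> ('k, 'n) pspace set \<Rightarrow> ('n, 'k) mpoly set" where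
  "secant_scheme_ideal L X =
     ideal.span (vanishing_ideal X \<union> vanishing_ideal (cone_over L (sing_locus L X)))"

text \<open>
  The closed subscheme \<open>V(J)\<close> is the hypersurface of the linear space \<open>M\<close> defined by one
  quadratic form which is not zero on \<open>M\<close>.
\<close>

definition quadric_in ::
    "('k::field, 'n::finite) pspace set \<Rightarrow> ('n, 'k) mpoly set \<Rightarrow> bool" where
  "quadric_in M J \<longleftrightarrow> linear_subspace M \<and>
     (\<exists>Q. homogeneous 2 Q \<and> Q \<notin> vanishing_ideal M \<and>
          saturation J = saturation (ideal.span (insert Q (vanishing_ideal M))))"

section \<open>The two exact sequences\<close>

text \<open>
  \<open>0 \<rightarrow> S\<^bsub>X\<^sub>q\<^esub> \<rightarrow> E \<rightarrow> S\<^sub>\<Lambda>(-1) \<rightarrow> 0\<close> as graded \<open>S\<close>-modules. The map \<open>\<rho>\<close> is given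
  degree by degree; \<open>G \<in> S\<close> acts on \<open>E\<close> through \<open>G \<circ> L\<close>.
\<close>

definition projection_pullback :: "'k::field^'n::finite^'m::finite \<Rightarrow> ('k, 'n) pspace set \<Rightarrow>
    ('k^'m \<Rightarrow> 'k) \<Rightarrow> ('k^'n \<Rightarrow> 'k)" where
  "projection_pullback L X g = restr_cone X (\<lambda>v. g (L *v v))"

definition coordinate_ring_sequence :: "'k::field^'n::finite^'m::finite \<Rightarrow>
    ('k, 'n) pspace set \<Rightarrow> ('k, 'm) pspace set \<Rightarrow> bool" where
  "coordinate_ring_sequence L X Z \<longleftrightarrow> (\<exists>\<rho> :: int \<Rightarrow> ('k^'n \<Rightarrow> 'k) \<Rightarrow> ('k^'m \<Rightarrow> 'k).
     (\<forall>j. \<forall>s\<in>twist_sections j X. \<forall>t\<in>twist_sections j X. \<rho> j (s + t) = \<rho> j s + \<rho> j t) \<and>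
     (\<forall>j d G. homogeneous d G \<longrightarrow> (\<forall>s\<in>twist_sections j X.
        \<rho> (d + j) ((\<lambda>v. poly_eval G (L *v v)) * s) = poly_eval G * \<rho> j s)) \<and>
     (\<forall>j. inj_on (projection_pullback L X) (coordinate_ring (proj_map L ` X) j)) \<and>
     (\<forall>j. projection_pullback L X ` coordinate_ring (proj_map L ` X) j =
          {s \<in> twist_sections j X. \<rho> j s = 0}) \<and>
     (\<forall>j. \<rho> j ` twist_sections j X = coordinate_ring Z (j - 1)))"

text \<open>
  Sheaves of abelian groups on \<open>T\<close> are given by their groups of sections \<open>A U\<close> together
  with restriction maps \<open>r V\<close> to the smaller open set \<open>V\<close>. Exactness is exactness of
  sheaves: kernels and images are compared locally.
\<close>

definition sheaf_hom :: "'a topology \<Rightarrow> ('a set \<Rightarrow> 'b::ab_group_add set) \<Rightarrow> ('a set \<Rightarrow> 'b \<Rightarrow> 'b) \<Rightarrow>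
    ('a set \<Rightarrow> 'c::ab_group_add set) \<Rightarrow> ('a set \<Rightarrow> 'c \<Rightarrow> 'c) \<Rightarrow> ('a set \<Rightarrow> 'b \<Rightarrow> 'c) \<Rightarrow> bool" where
  "sheaf_hom T A rA B rB f \<longleftrightarrow> (\<forall>U. openin T U \<longrightarrow>
     f U ` A U \<subseteq> B U \<and>
     (\<forall>s\<in>A U. \<forall>t\<in>A U. f U (s + t) = f U s + f U t) \<and>
     (\<forall>V. openin T V \<and> V \<subseteq> U \<longrightarrow> (\<forall>s\<in>A U. f V (rA V s) = rB V (f U s))))"

definition sheaf_short_exact :: "'a topology \<Rightarrow>
    ('a set \<Rightarrow> 'b::ab_group_add set) \<Rightarrow> ('a set \<Rightarrow> 'b \<Rightarrow> 'b) \<Rightarrow>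
    ('a set \<Rightarrow> 'c::ab_group_add set) \<Rightarrow> ('a set \<Rightarrow> 'c \<Rightarrow> 'c) \<Rightarrow>
    ('a set \<Rightarrow> 'd::ab_group_add set) \<Rightarrow> ('a set \<Rightarrow> 'd \<Rightarrow> 'd) \<Rightarrow>
    ('a set \<Rightarrow> 'b \<Rightarrow> 'c) \<Rightarrow> ('a set \<Rightarrow> 'c \<Rightarrow> 'd) \<Rightarrow> bool" where
  "sheaf_short_exact T A rA B rB C rC f g \<longleftrightarrow>
     sheaf_hom T A rA B rB f \<and> sheaf_hom T B rB C rC g \<and>
     (\<forall>U. openin T U \<longrightarrow>
        inj_on (f U) (A U) \<and>
        (\<forall>s\<in>B U. g U s = 0 \<longleftrightarrow>
           (\<forall>y\<in>U. \<exists>V. openin T V \<and> y \<in> V \<and> V \<subseteq> U \<and> rB V s \<in> f V ` A V)) \<and>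
        (\<forall>t\<in>C U. \<forall>y\<in>U. \<exists>V. openin T V \<and> y \<in> V \<and> V \<subseteq> U \<and> rC V t \<in> g V ` B V))"

text \<open>
  \<open>0 \<rightarrow> \<O>\<^bsub>X\<^sub>q\<^esub> \<rightarrow> (\<pi>\<^sub>q)\<^sub>*\<O>\<^sub>X \<rightarrow> \<O>\<^sub>\<Lambda>(-1) \<rightarrow> 0\<close> as sheaves of modules over the structure
  sheaf of the target projective space; the last clause is linearity of \<open>\<sigma>\<close>.
\<close>

definition structure_sheaf_sequence :: "'k::field^'n::finite^'m::finite \<Rightarrow>
    ('k, 'n) pspace set \<Rightarrow> ('k, 'm) pspace set \<Rightarrow> bool" where
  "structure_sheaf_sequence L X Z \<longleftrightarrow>
     (\<exists>\<sigma> :: ('k, 'm) pspace set \<Rightarrow> (('k, 'n) pspace \<Rightarrow> 'k) \<Rightarrow> ('k^'m \<Rightarrow> 'k).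
        sheaf_short_exact zariski
          (\<lambda>U. regular (proj_map L ` X \<inter> U)) restr
          (\<lambda>U. regular (X \<inter> proj_map L -` U)) (\<lambda>V. restr (proj_map L -` V))
          (\<lambda>U. twist_sections (-1) (Z \<inter> U)) restr_cone
          (\<lambda>U s. restr X (s \<circ> proj_map L)) \<sigma> \<and>
        (\<forall>U h. openin zariski U \<longrightarrow> h \<in> regular U \<longrightarrow>
           (\<forall>s\<in>regular (X \<inter> proj_map L -` U).
              \<sigma> U ((h \<circ> proj_map L) * s) = (h \<circ> point) * \<sigma> U s)))"

end

theory Submission
  imports Defs
begin

text \<open>
  Let \<open>S\<close> be the coordinate ring of the target of the projection and let \<open>\<xi>\<close> be a linear form with
  \<open>\<xi>(q) = 1\<close>, so that the coordinate ring of the source is \<open>S[\<xi>]\<close>. If \<open>\<xi>\<close> agreed on \<open>X\<close> with a linear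
  form of \<open>S\<close>, then \<open>X\<close> would lie in a hyperplane. By nondegeneracy, \<open>\<xi>\<close> is therefore mapped to a
  nonzero constant in degree 1 of \<open>S\<^sub>\<Lambda>(-1)\<close>, hence to a generator, and the exact sequence says: for
  \<open>G\<close> in \<open>S\<close>, the function \<open>G \<xi>\<close> agrees on \<open>X\<close> with an element of \<open>S\<close> if and only if \<open>G\<close> vanishes on
  \<open>\<Lambda>\<close>. Moreover \<open>\<xi>\<^sup>2\<close> is, on \<open>X\<close>, a combination \<open>-\<beta> \<xi> - \<gamma>\<close> with \<open>\<beta>\<close>, \<open>\<gamma>\<close> in \<open>S\<close>. These facts are
  collected in the locale \<open>conductor_data\<close>, and everything else follows from them.

  The form \<open>quad = \<xi>\<^sup>2 + \<beta> \<xi> + \<gamma>\<close> vanishes on \<open>X\<close> and is monic in \<open>\<xi>\<close>, so every form can be written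
  as \<open>A quad + G \<xi> + H\<close> with \<open>G\<close>, \<open>H\<close> in \<open>S\<close>. If it vanishes on \<open>X\<close>, so does \<open>G \<xi> + H\<close>, whence \<open>G\<close>
  vanishes on \<open>\<Lambda>\<close>; multiplying by \<open>\<xi>\<close> and reducing \<open>\<xi>\<^sup>2\<close> shows that \<open>H\<close> vanishes on \<open>\<Lambda>\<close> too. Thus over
  \<open>\<Lambda>\<close> all elements of the ideal of \<open>X\<close> are multiples of \<open>quad\<close>
  (\<open>vanishing_form_is_multiple_of_quad\<close>), that is, \<open>X\<close> meets \<open>\<langle>q, \<Lambda>\<rangle>\<close> in the quadric \<open>quad = 0\<close>.

  In particular the line through \<open>q\<close> over a point of \<open>\<Lambda>\<close> meets \<open>X\<close> in a scheme defined by one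
  monic quadratic equation, of length 2. For a point \<open>y\<close> outside \<open>\<Lambda>\<close> there is a linear form \<open>g\<close> with
  \<open>g(y) \<noteq> 0\<close> vanishing on \<open>\<Lambda>\<close>, hence a relation \<open>g \<xi> = H\<close> on \<open>X\<close> with \<open>H\<close> in \<open>S\<close>. It determines
  \<open>\<xi>\<close> where \<open>g \<noteq> 0\<close>: no line through \<open>q\<close> over such a point is a secant, and the projection has the
  inverse \<open>\<xi> = H / g\<close> there. At a point of \<open>\<Lambda>\<close> the projection is not an isomorphism, because
  \<open>\<O>\<^sub>\<Lambda>(-1)\<close>, the cokernel of \<open>\<O> \<rightarrow> \<pi>\<^sub>*\<O>\<^sub>X\<close>, has a nonzero local section. So \<open>\<Lambda>\<close> is both the image of
  the secant locus and the singular locus of the projection.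

  Birationality requires a point of \<open>X\<close> outside the cone over \<open>\<Lambda>\<close>. If there were none,
  nondegeneracy would force \<open>\<Lambda>\<close> to be the whole target, the ideal of \<open>X\<close> would be generated by \<open>quad\<close>,
  and \<open>X\<close> would be a hypersurface, contrary to the assumption on the codimension.
\<close>

section \<open>Forms as functions\<close>

definition monomial_eval :: "('n::finite \<Rightarrow>\<^sub>0 nat) \<Rightarrow> 'k::field^'n \<Rightarrow> 'k" where
  "monomial_eval m v = (\<Prod>i\<in>UNIV. v $ i ^ Poly_Mapping.lookup m i)"

definition monomial_degree :: "('n::finite \<Rightarrow>\<^sub>0 nat) \<Rightarrow> nat" where
  "monomial_degree m = (\<Sum>i\<in>UNIV. Poly_Mapping.lookup m i)"

lemma homogeneous_iff: "homogeneous d F \<longleftrightarrow> (\<forall>m\<in>Poly_Mapping.keys F. int (monomial_degree m) = d)"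
  by (simp add: homogeneous_def monomial_degree_def)

lemma poly_eval_superset:
  assumes "finite S" "Poly_Mapping.keys F \<subseteq> S"
  shows "poly_eval F v = (\<Sum>m\<in>S. Poly_Mapping.lookup F m * monomial_eval m v)"
  unfolding poly_eval_def monomial_eval_def[symmetric]
  by (rule sum.mono_neutral_left) (use assms in \<open>auto simp: in_keys_iff\<close>)

lemma poly_eval_0 [simp]: "poly_eval 0 v = 0"
  by (simp add: poly_eval_def)

lemma poly_eval_add [simp]: "poly_eval (F + G) v = poly_eval F v + poly_eval G v"
proof -
  let ?S = "Poly_Mapping.keys F \<union> Poly_Mapping.keys G"
  have "Poly_Mapping.keys (F + G) \<subseteq> ?S" by (rule keys_add)
  then show ?thesis
    by (simp add: poly_eval_superset[of ?S] lookup_add distrib_right sum.distrib)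
qed

lemma poly_eval_sum: "poly_eval (sum F S) v = (\<Sum>x\<in>S. poly_eval (F x) v)"
  by (induction S rule: infinite_finite_induct) simp_all

lemma poly_eval_single [simp]: "poly_eval (Poly_Mapping.single m c) v = c * monomial_eval m v"
  by (subst poly_eval_superset[of "{m}"]) auto

lemma poly_as_sum_of_monomials:
  "(F :: ('n::finite, 'k::field) mpoly) =
     (\<Sum>m\<in>Poly_Mapping.keys F. Poly_Mapping.single m (Poly_Mapping.lookup F m))"
  by (rule poly_mapping_eqI)
    (auto simp: lookup_sum lookup_single when_def sum.delta in_keys_iff cong: if_cong)

lemma monomial_eval_add: "monomial_eval (m + m') v = monomial_eval m v * monomial_eval m' v"
  by (simp add: monomial_eval_def lookup_add power_add prod.distrib)

lemma monomial_degree_add: "monomial_degree (m + m') = monomial_degree m + monomial_degree m'"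
  by (simp add: monomial_degree_def lookup_add sum.distrib)

lemma poly_eval_mult [simp]: "poly_eval (F * G) v = poly_eval F v * poly_eval G v"
proof -
  have "F * G = (\<Sum>m\<in>Poly_Mapping.keys F. \<Sum>m'\<in>Poly_Mapping.keys G.
      Poly_Mapping.single (m + m') (Poly_Mapping.lookup F m * Poly_Mapping.lookup G m'))"
  proof -
    have "F * G = (\<Sum>m\<in>Poly_Mapping.keys F. Poly_Mapping.single m (Poly_Mapping.lookup F m)) *
        (\<Sum>m\<in>Poly_Mapping.keys G. Poly_Mapping.single m (Poly_Mapping.lookup G m))"
      by (simp only: poly_as_sum_of_monomials[symmetric])
    then show ?thesis by (simp only: sum_product mult_single)
  qed
  then have "poly_eval (F * G) v = (\<Sum>m\<in>Poly_Mapping.keys F. \<Sum>m'\<in>Poly_Mapping.keys G.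
      (Poly_Mapping.lookup F m * monomial_eval m v) * (Poly_Mapping.lookup G m' * monomial_eval m' v))"
    by (simp only: poly_eval_sum poly_eval_single monomial_eval_add mult_ac)
  also have "\<dots> = poly_eval F v * poly_eval G v"
    by (simp add: sum_product poly_eval_def monomial_eval_def)
  finally show ?thesis .
qed

lemma poly_eval_diff [simp]: "poly_eval (F - G) v = poly_eval F v - poly_eval G v"
  using poly_eval_add[of "F - G" G v] by (simp del: poly_eval_add)

lemma poly_eval_scale [simp]: "poly_eval (poly_scale c F) v = c * poly_eval F v"
  by (simp add: poly_scale_def monomial_eval_def)

lemma homogeneous_0 [simp]: "homogeneous d 0"
  by (simp add: homogeneous_def)

lemma homogeneous_add: "homogeneous d F \<Longrightarrow> homogeneous d G \<Longrightarrow> homogeneous d (F + G)"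
  using keys_add[of F G] by (auto simp: homogeneous_iff)

lemma homogeneous_single: "d = int (monomial_degree m) \<Longrightarrow> homogeneous d (Poly_Mapping.single m c)"
  by (auto simp: homogeneous_iff)

lemma homogeneous_mult:
  assumes "homogeneous d F" "homogeneous e G"
  shows "homogeneous (d + e) (F * G)"
  unfolding homogeneous_iff
proof
  fix m assume "m \<in> Poly_Mapping.keys (F * G)"
  then obtain a b where "m = a + b" "a \<in> Poly_Mapping.keys F" "b \<in> Poly_Mapping.keys G"
    using keys_mult[of F G] by blast
  then show "int (monomial_degree m) = d + e"
    using assms by (auto simp: homogeneous_iff monomial_degree_add)
qed

lemma homogeneous_scale: "homogeneous d F \<Longrightarrow> homogeneous d (poly_scale c F)"
  using homogeneous_mult[OF homogeneous_single[of 0 0 c], of d F]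
  by (simp add: poly_scale_def monomial_degree_def)

lemma homogeneous_diff:
  fixes F G :: "('n::finite, 'k::field) mpoly"
  assumes "homogeneous d F" "homogeneous d G"
  shows "homogeneous d (F - G)"
proof -
  have "F - G = F + poly_scale (- 1) G"
    by (simp add: poly_scale_def single_uminus)
  then show ?thesis
    using assms by (metis homogeneous_add homogeneous_scale)
qed

text \<open>
  The hypotheses on \<open>X\<close> and \<open>\<Lambda>\<close> speak of values of polynomials, and composition with \<open>L\<close> is
  immediate for functions; hence forms are treated as functions, and polynomials return only where
  ideals and dimensions are concerned.
\<close>

definition form :: "int \<Rightarrow> ('k::field^'n::finite \<Rightarrow> 'k) \<Rightarrow> bool" where
  "form d f \<longleftrightarrow> (\<exists>F. homogeneous d F \<and> f = poly_eval F)"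

lemma form_poly_eval: "homogeneous d F \<Longrightarrow> form d (poly_eval F)"
  by (auto simp: form_def)

lemma form_0: "form d (\<lambda>v. 0)"
  unfolding form_def by (rule exI[of _ 0]) auto

lemma form_add:
  assumes "form d f" "form d g"
  shows "form d (\<lambda>v. f v + g v)"
proof -
  obtain F G where "homogeneous d F" "homogeneous d G" "f = poly_eval F" "g = poly_eval G"
    using assms unfolding form_def by blast
  then show ?thesis
    unfolding form_def by (intro exI[of _ "F + G"]) (simp add: fun_eq_iff homogeneous_add)
qed

lemma form_diff:
  assumes "form d f" "form d g"
  shows "form d (\<lambda>v. f v - g v)"
proof -
  obtain F G where "homogeneous d F" "homogeneous d G" "f = poly_eval F" "g = poly_eval G"
    using assms unfolding form_def by blast
  then show ?thesis
    unfolding form_def by (intro exI[of _ "F - G"]) (simp add: fun_eq_iff homogeneous_diff)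
qed

lemma form_mult:
  assumes "form d f" "form e g"
  shows "form (d + e) (\<lambda>v. f v * g v)"
proof -
  obtain F G where "homogeneous d F" "homogeneous e G" "f = poly_eval F" "g = poly_eval G"
    using assms unfolding form_def by blast
  then show ?thesis
    unfolding form_def by (intro exI[of _ "F * G"]) (simp add: fun_eq_iff homogeneous_mult)
qed

lemma form_const: "form 0 (\<lambda>v. c)"
  unfolding form_def
  by (rule exI[of _ "Poly_Mapping.single 0 c"])
    (auto simp: homogeneous_single monomial_degree_def monomial_eval_def)

lemma form_cmult: "form d f \<Longrightarrow> form d (\<lambda>v. c * f v)"
  using form_mult[OF form_const[of c]] by fastforce

lemma form_uminus: "form d f \<Longrightarrow> form d (\<lambda>v. - f v)"
  using form_cmult[of d f "- 1"] by simp

lemma form_sum: "(\<And>x. x \<in> S \<Longrightarrow> form d (f x)) \<Longrightarrow> form d (\<lambda>v. \<Sum>x\<in>S. f x v)"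
  by (induction S rule: infinite_finite_induct) (auto intro: form_0 form_add)

lemma form_power: "form d f \<Longrightarrow> form (int n * d) (\<lambda>v. f v ^ n)"
proof (induction n)
  case (Suc n)
  then show ?case
    using form_mult[of d f "int n * d" "\<lambda>v. f v ^ n"] by (simp add: algebra_simps)
qed (simp add: form_const)

lemma monomial_eval_single: "monomial_eval (Poly_Mapping.single i 1) v = v $ i"
proof -
  have "monomial_eval (Poly_Mapping.single i 1) v = (\<Prod>j\<in>UNIV. if j = i then v $ i else 1)"
    unfolding monomial_eval_def by (rule prod.cong) (auto simp: lookup_single when_def)
  then show ?thesis by simp
qed

lemma monomial_degree_single: "monomial_degree (Poly_Mapping.single i k) = k"
proof -
  have "monomial_degree (Poly_Mapping.single i k) = (\<Sum>j\<in>UNIV. if j = i then k else 0)"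
    unfolding monomial_degree_def by (rule sum.cong) (auto simp: lookup_single when_def)
  then show ?thesis by simp
qed

lemma form_coordinate: "form 1 (\<lambda>v. v $ i)"
  using form_poly_eval[OF homogeneous_single[OF refl, of "Poly_Mapping.single i 1" 1]]
  by (simp add: monomial_degree_single monomial_eval_single[simplified] poly_eval_single[abs_def])

lemma form_matrix: "form 1 (\<lambda>v. (A *v v) $ i)"
  by (auto simp: matrix_vector_mult_def intro!: form_sum form_cmult form_coordinate)

text \<open>Splitting off one variable makes induction on the degree possible for monomials.\<close>

lemma split_variable_off_monomial:
  assumes "monomial_degree m = Suc k"
  obtains i m' where "m = Poly_Mapping.single i 1 + m'" "monomial_degree m' = k"
proof -
  obtain i where i: "Poly_Mapping.lookup m i \<noteq> 0"
    using assms unfolding monomial_degree_def by (metis nat.simps(3) sum.neutral)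
  define m' where "m' = m - Poly_Mapping.single i 1"
  have "m = Poly_Mapping.single i 1 + m'"
    by (rule poly_mapping_eqI)
      (use i in \<open>auto simp: m'_def lookup_add lookup_minus lookup_single when_def\<close>)
  then show ?thesis
    using assms that[of i m'] by (simp add: monomial_degree_add monomial_degree_single)
qed

text \<open>
  A monomial of positive degree is a coordinate times a monomial of the next lower degree, so that
  all forms arise from constants by addition and multiplication by coordinates. The zero function
  is a form of every degree and needs a case of its own.
\<close>

lemma form_induct [consumes 1, case_names const zero add coordinate]:
  fixes f :: "'k::field^'n::finite \<Rightarrow> 'k"
  assumes "form d f"
    and const: "\<And>c. P 0 (\<lambda>v. c)"
    and zero: "\<And>d. P d (\<lambda>v. 0)"
    and add: "\<And>d f g. form d f \<Longrightarrow> form d g \<Longrightarrow> P d f \<Longrightarrow> P d g \<Longrightarrow> P d (\<lambda>v. f v + g v)"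
    and coordinate: "\<And>d f i. form d f \<Longrightarrow> 0 \<le> d \<Longrightarrow> P d f \<Longrightarrow> P (1 + d) (\<lambda>v. v $ i * f v)"
  shows "P d f"
proof -
  obtain F where F: "homogeneous d F" "f = poly_eval F"
    using assms(1) by (auto simp: form_def)
  have form_of_monomial: "form (int (monomial_degree m)) (\<lambda>v. c * monomial_eval m v)" for m :: "'n \<Rightarrow>\<^sub>0 nat" and c :: 'k
    using form_poly_eval[OF homogeneous_single[OF refl, of m c]] by (simp add: poly_eval_single[abs_def])
  have monomial: "P (int k) (\<lambda>v. c * monomial_eval m v)" if "monomial_degree m = k" for k m c
    using that
  proof (induction k arbitrary: m)
    case 0
    then have "m = 0"
      by (intro poly_mapping_eqI) (simp add: monomial_degree_def)
    then show ?case
      using const[of c] by (simp add: monomial_eval_def)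
  next
    case (Suc k)
    obtain i m' where m: "m = Poly_Mapping.single i 1 + m'" "monomial_degree m' = k"
      using split_variable_off_monomial[OF Suc.prems] .
    have "P (1 + int k) (\<lambda>v. v $ i * (c * monomial_eval m' v))"
      using coordinate[OF form_of_monomial[of m' c] _ , of i] Suc.IH[OF m(2)] m(2) by simp
    moreover have "(\<lambda>v. v $ i * (c * monomial_eval m' v)) = (\<lambda>v. c * monomial_eval m v)"
      by (simp only: m(1) monomial_eval_add monomial_eval_single mult_ac)
    ultimately show ?case by simp
  qed
  have "P d (\<lambda>v. \<Sum>m\<in>S. Poly_Mapping.lookup F m * monomial_eval m v) \<and>
      form d (\<lambda>v. \<Sum>m\<in>S. Poly_Mapping.lookup F m * monomial_eval m v)"
    if "finite S" "S \<subseteq> Poly_Mapping.keys F" for S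
    using that
  proof (induction S rule: finite_induct)
    case empty
    then show ?case by (simp add: zero form_0)
  next
    case (insert m S)
    then have "int (monomial_degree m) = d"
      using F(1) by (auto simp: homogeneous_iff)
    then show ?case
      using insert form_of_monomial[of m "Poly_Mapping.lookup F m"]
        monomial[OF refl, of m "Poly_Mapping.lookup F m"]
      by (auto intro!: add form_add)
  qed
  from this[of "Poly_Mapping.keys F"] show ?thesis
    unfolding F(2) by (simp add: poly_eval_def[abs_def] monomial_eval_def)
qed

lemma form_negative: "form d f \<Longrightarrow> d < 0 \<Longrightarrow> f = (\<lambda>v. 0)"
  by (induction rule: form_induct) auto

lemma form_degree_0: "form d f \<Longrightarrow> d = 0 \<Longrightarrow> f v = f w"
proof (induction rule: form_induct)
  case (add d f g)
  then show ?case by metis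
qed auto

lemma form_scaling: "form d f \<Longrightarrow> f (c *s v) = c ^ nat d * f v"
proof (induction rule: form_induct)
  case (coordinate d f i)
  then show ?case by (simp add: nat_add_distrib)
qed (simp_all add: distrib_left)

lemma form_at_0: "form d f \<Longrightarrow> 0 < d \<Longrightarrow> f 0 = 0"
  using form_scaling[of d f 0 0] by (simp add: power_0_left)

lemma form_1_additive:
  fixes f :: "'k::field^'n::finite \<Rightarrow> 'k"
  shows "form d f \<Longrightarrow> d = 1 \<Longrightarrow> f (v + w) = f v + f w"
proof (induction rule: form_induct)
  case (coordinate d f i)
  then have "f u = f 0" for u
    using form_degree_0[of d f] by simp
  then have "f (v + w) = f 0" "f v = f 0" "f w = f 0" by blast+
  then show ?case by (simp add: distrib_right)
qed (auto simp: algebra_simps)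

lemma form_compose:
  assumes "form d f" "\<And>i. form e (\<lambda>v. \<Phi> v $ i)"
  shows "form (d * e) (\<lambda>v. f (\<Phi> v))"
  using assms(1)
proof (induction rule: form_induct)
  case (coordinate d f i)
  then show ?case
    using form_mult[OF assms(2)[of i]] by (simp add: distrib_right)
qed (auto intro: form_const form_0 form_add)

lemma form_compose_matrix: "form d f \<Longrightarrow> form d (\<lambda>v. f (A *v v))"
  using form_compose[of d f 1 "(*v) A"] form_matrix[of A] by simp

text \<open>Extend a basis of \<open>W\<close> and \<open>y\<close> to a linear map fixing \<open>y\<close> and killing \<open>W\<close>; some component of it works.\<close>

lemma linear_form_separating:
  fixes y :: "'k::field^'m::finite"
  assumes "vec.subspace W" "y \<notin> W"
  obtains g where "form 1 g" "\<And>w. w \<in> W \<Longrightarrow> g w = 0" "g y \<noteq> 0"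
proof -
  obtain C where C: "C \<subseteq> W" "vec.independent C" "W \<subseteq> vec.span C"
    using vec.basis_exists by metis
  have "vec.span C \<subseteq> W"
    using C(1) assms(1) by (rule vec.span_minimal)
  then have "y \<notin> vec.span C"
    using assms(2) by blast
  then have "vec.independent (insert y C)"
    using C(2) by (rule vec.independent_insertI)
  then obtain h where h: "Vector_Spaces.linear (*s) (*s) h"
    "\<forall>x\<in>insert y C. h x = (if x = y then y else 0)"
    using vec.linear_independent_extend[of "insert y C" "\<lambda>x. if x = y then y else 0"] by blast
  have "h x = 0" if "x \<in> C" for x
    using h(2) that \<open>y \<notin> vec.span C\<close> vec.span_base[OF that] by auto
  then have zero: "h w = 0" if "w \<in> W" for w
    using vec.linear_eq_0_on_span[OF h(1), of C w] C(3) that by auto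
  have "y \<noteq> 0"
    using assms vec.subspace_0 by blast
  then obtain i where i: "y $ i \<noteq> 0"
    by (metis vec_eq_iff zero_index)
  have "form 1 (\<lambda>w. (matrix h *v w) $ i)"
    by (rule form_matrix)
  then have "form 1 (\<lambda>w. h w $ i)"
    by (simp add: matrix_works[OF h(1)])
  then show thesis
    using that[of "\<lambda>w. h w $ i"] zero h(2) i by simp
qed

section \<open>Polynomial functions over an algebraically closed field\<close>

text \<open>Over a finite field the polynomial \<open>1 + \<Prod>\<^sub>a (x - a)\<close> has no root.\<close>

lemma infinite_UNIV_alg_closed: "infinite (UNIV :: 'k::alg_closed_field set)"
proof
  assume fin: "finite (UNIV :: 'k set)"
  define p :: "'k poly" where "p = (\<Prod>a\<in>UNIV. [:- a, 1:]) + 1"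
  have "degree (\<Prod>a\<in>UNIV. [:- a, 1 :: 'k:]) = card (UNIV :: 'k set)"
    by (subst degree_prod_sum_eq) auto
  moreover have "card (UNIV :: 'k set) > 0"
    using fin by (simp add: card_gt_0_iff)
  ultimately have "degree p > 0"
    unfolding p_def by (subst degree_add_eq_left) auto
  then obtain a where "poly p a = 0"
    using alg_closed_imp_poly_has_root by blast
  moreover have "poly (\<Prod>b\<in>UNIV. [:- b, 1 :: 'k:]) a = 0"
    using fin by (auto simp: poly_prod)
  ultimately show False by (simp add: p_def)
qed

lemma poly_eqI_alg_closed:
  fixes p q :: "'k::alg_closed_field poly"
  assumes "\<And>a. poly p a = poly q a"
  shows "p = q"
proof (rule ccontr)
  assume "p \<noteq> q"
  then have "finite {a. poly (p - q) a = 0}"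
    by (intro poly_roots_finite) simp
  then show False
    using assms infinite_UNIV_alg_closed[where 'k = 'k] by simp
qed

text \<open>This reduces divisibility questions on lines through \<open>q\<close> to polynomials in one variable.\<close>

lemma poly_eval_on_line:
  "\<exists>P. \<forall>a. poly P a = poly_eval F (a *s u + w)"
proof -
  define P where "P = (\<Sum>m\<in>Poly_Mapping.keys F. [:Poly_Mapping.lookup F m:] *
    (\<Prod>i\<in>UNIV. [:w $ i, u $ i:] ^ Poly_Mapping.lookup m i))"
  have "poly P a = poly_eval F (a *s u + w)" for a
    by (simp add: P_def poly_eval_def poly_sum poly_prod add.commute)
  then show ?thesis by blast
qed

text \<open>
  Over an infinite field the ideal of a cone is homogeneous: on a line through the origin, a
  polynomial restricts to a polynomial in the scalar, whose coefficients are the values of the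
  homogeneous components.
\<close>

lemma poly_eval_homogeneous_components:
  fixes F :: "('n::finite, 'k::alg_closed_field) mpoly"
  obtains N f where "\<And>j. form (int j) (f j)" "poly_eval F = (\<lambda>v. \<Sum>j<N. f j v)"
    "\<And>v j. (\<And>c. poly_eval F (c *s v) = 0) \<Longrightarrow> j < N \<Longrightarrow> f j v = 0"
proof -
  define f where "f = (\<lambda>j v. \<Sum>m\<in>{m\<in>Poly_Mapping.keys F. monomial_degree m = j}.
    Poly_Mapping.lookup F m * monomial_eval m v)"
  have f: "form (int j) (f j)" for j
    unfolding f_def
  proof (rule form_sum)
    fix m assume "m \<in> {m \<in> Poly_Mapping.keys F. monomial_degree m = j}"
    then show "form (int j) (\<lambda>v. Poly_Mapping.lookup F m * monomial_eval m v)"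
      using form_poly_eval[OF homogeneous_single[OF refl, of m "Poly_Mapping.lookup F m"]]
      by (simp add: poly_eval_single[abs_def])
  qed
  define N where "N = Suc (Max (insert 0 (monomial_degree ` Poly_Mapping.keys F)))"
  have N: "monomial_degree m < N" if "m \<in> Poly_Mapping.keys F" for m
    using that by (auto simp: N_def less_Suc_eq_le)
  have sum: "poly_eval F v = (\<Sum>j<N. f j v)" for v
  proof -
    have "(\<Sum>j<N. f j v) = (\<Sum>m\<in>Poly_Mapping.keys F. Poly_Mapping.lookup F m * monomial_eval m v)"
      unfolding f_def by (rule sum.group) (use N in auto)
    then show ?thesis by (simp add: poly_eval_def monomial_eval_def)
  qed
  have "f j v = 0" if "\<And>c. poly_eval F (c *s v) = 0" "j < N" for v j
  proof -
    define p where "p = (\<Sum>j<N. monom (f j v) j)"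
    have "poly p c = 0" for c
      using that(1)[of c] form_scaling[OF f]
      by (simp add: sum p_def poly_sum poly_monom mult.commute)
    then have "p = 0"
      by (intro poly_eqI_alg_closed) simp
    then have "coeff p j = 0" by simp
    then show ?thesis
      using that(2) by (simp add: p_def coeff_sum sum.delta)
  qed
  with f sum that show thesis by blast
qed

section \<open>Hilbert functions\<close>

lemma finite_monomials: "finite {m :: 'n::finite \<Rightarrow>\<^sub>0 nat. monomial_degree m = d}"
proof (rule finite_imageD)
  have "Poly_Mapping.lookup m i \<le> d" if "monomial_degree m = d" for m :: "'n \<Rightarrow>\<^sub>0 nat" and i
    using that member_le_sum[of i UNIV "Poly_Mapping.lookup m"] by (simp add: monomial_degree_def)
  then show "finite (Poly_Mapping.lookup ` {m :: 'n \<Rightarrow>\<^sub>0 nat. monomial_degree m = d})"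
    by (intro finite_subset[OF _ finite_PiE[of UNIV "\<lambda>_. {..d}"]]) auto
  show "inj_on Poly_Mapping.lookup {m :: 'n \<Rightarrow>\<^sub>0 nat. monomial_degree m = d}"
    by (simp add: inj_on_def)
qed

lemma homogeneous_subset_span_monomials:
  "{F :: ('n::finite, 'k::field) mpoly. homogeneous (int d) F}
     \<subseteq> mpoly.span ((\<lambda>m. Poly_Mapping.single m 1) ` {m. monomial_degree m = d})"
proof
  fix F :: "('n, 'k) mpoly"
  assume "F \<in> {F. homogeneous (int d) F}"
  then have *: "monomial_degree m = d" if "m \<in> Poly_Mapping.keys F" for m
    using that by (auto simp: homogeneous_iff)
  have "(\<Sum>m\<in>Poly_Mapping.keys F. poly_scale (Poly_Mapping.lookup F m) (Poly_Mapping.single m 1))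
      \<in> mpoly.span ((\<lambda>m. Poly_Mapping.single m 1) ` {m. monomial_degree m = d})"
    by (intro mpoly.span_sum mpoly.span_scale mpoly.span_base) (use * in auto)
  also have "(\<Sum>m\<in>Poly_Mapping.keys F. poly_scale (Poly_Mapping.lookup F m) (Poly_Mapping.single m 1)) = F"
    by (subst (3) poly_as_sum_of_monomials) (simp add: poly_scale_def mult_single)
  finally show "F \<in> mpoly.span ((\<lambda>m. Poly_Mapping.single m 1) ` {m. monomial_degree m = d})" .
qed

context vector_space
begin

lemma dim_le_dim_plus_1:
  assumes "V \<subseteq> span W" "finite W" "U \<subseteq> V" "V \<subseteq> span (insert a U)"
  shows "dim V \<le> dim U + 1"
proof -
  obtain B where B: "B \<subseteq> U" "independent B" "U \<subseteq> span B" "card B = dim U"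
    using basis_exists .
  have "finite B"
    using independent_span_bound[OF assms(2) B(2)] B(1) assms by blast
  have "span (insert a U) \<subseteq> span (insert a B)"
    by (rule span_minimal) (use B(3) span_mono[of B "insert a B"] span_base in \<open>auto\<close>)
  then have "dim V \<le> card (insert a B)"
    using assms(4) \<open>finite B\<close> by (intro dim_le_card) auto
  also have "\<dots> \<le> dim U + 1"
    using B(4) \<open>finite B\<close> by (simp add: card_insert_if)
  finally show ?thesis .
qed

lemma dim_plus_2_le_dim:
  assumes "V \<subseteq> span W" "finite W" "U \<subseteq> V" "a \<in> V" "b \<in> V"
    and indep: "\<And>x y. x *s a + y *s b \<in> span U \<Longrightarrow> x = 0 \<and> y = 0"
  shows "dim U + 2 \<le> dim V"
proof -
  obtain B where B: "B \<subseteq> U" "independent B" "U \<subseteq> span B" "card B = dim U"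
    using basis_exists .
  obtain C where C: "C \<subseteq> V" "independent C" "V \<subseteq> span C" "card C = dim V"
    using basis_exists .
  have "finite B" "finite C"
    using independent_span_bound[OF assms(2) B(2)] B(1)
      independent_span_bound[OF assms(2) C(2)] C(1) assms by blast+
  have sub: "span B \<subseteq> span U"
    using B(1) by (rule span_mono)
  have b: "b \<notin> span B"
    using indep[of 0 1] sub by auto
  have a: "a \<notin> span (insert b B)"
  proof
    assume "a \<in> span (insert b B)"
    then obtain k where "a - k *s b \<in> span B"
      using span_breakdown_eq by blast
    then show False
      using indep[of 1 "- k"] sub by auto
  qed
  have "independent (insert a (insert b B))"
    using a b B(2) by (intro independent_insertI)
  moreover have "insert a (insert b B) \<subseteq> span C"
    using assms(3-5) B(1) C(3) by blast
  ultimately have "card (insert a (insert b B)) \<le> card C"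
    using independent_span_bound[OF \<open>finite C\<close>] by blast
  moreover have "card (insert a (insert b B)) = card B + 2"
  proof -
    have "b \<notin> B" "a \<notin> insert b B"
      using a b span_base by blast+
    then show ?thesis using \<open>finite B\<close> by simp
  qed
  ultimately show ?thesis
    using B(4) C(4) by simp
qed

end

text \<open>
  The next two lemmas replace the computation of Hilbert functions by one spanning vector and two
  independent vectors modulo the ideal, respectively.
\<close>

lemma hilbert_function_le_1:
  fixes T :: "('n::finite, 'k::field) mpoly"
  assumes "homogeneous (int d) T"
    and "\<And>F. homogeneous (int d) F \<Longrightarrow> \<exists>c. F - poly_scale c T \<in> J"
  shows "hilbert_function J d \<le> 1"
proof -
  let ?V = "{F :: ('n, 'k) mpoly. homogeneous (int d) F}"
  let ?U = "{F \<in> J. homogeneous (int d) F}"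
  have "?V \<subseteq> mpoly.span (insert T ?U)"
  proof
    fix F assume "F \<in> ?V"
    then obtain c where "F - poly_scale c T \<in> J" "homogeneous (int d) F"
      using assms(2) by blast
    then have "F - poly_scale c T \<in> ?U"
      using assms(1) by (simp add: homogeneous_diff homogeneous_scale)
    then show "F \<in> mpoly.span (insert T ?U)"
      unfolding mpoly.span_breakdown_eq by (blast intro: mpoly.span_base)
  qed
  then have "mpoly.dim ?V \<le> mpoly.dim ?U + 1"
    by (intro mpoly.dim_le_dim_plus_1[OF homogeneous_subset_span_monomials])
      (auto simp: finite_monomials)
  then show ?thesis by (simp add: hilbert_function_def)
qed

lemma hilbert_function_ge_2:
  fixes F G :: "('n::finite, 'k::field) mpoly"
  assumes "mpoly.subspace J" "homogeneous (int d) F" "homogeneous (int d) G"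
    and "\<And>x y. poly_scale x F + poly_scale y G \<in> J \<Longrightarrow> x = 0 \<and> y = 0"
  shows "2 \<le> hilbert_function J d"
proof -
  let ?V = "{F :: ('n, 'k) mpoly. homogeneous (int d) F}"
  let ?U = "{F \<in> J. homogeneous (int d) F}"
  have "mpoly.span ?U \<subseteq> J"
    by (rule mpoly.span_minimal) (use assms(1) in auto)
  then have "mpoly.dim ?U + 2 \<le> mpoly.dim ?V"
    using assms by (intro mpoly.dim_plus_2_le_dim[OF homogeneous_subset_span_monomials, where a = F and b = G])
      (auto simp: finite_monomials)
  then show ?thesis by (simp add: hilbert_function_def)
qed

lemma scheme_length_ge_2:
  assumes "\<And>d. d \<ge> 2 \<Longrightarrow> 2 \<le> hilbert_function J d"
  shows "2 \<le> scheme_length J"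
  unfolding scheme_length_def
proof (rule Liminf_bounded)
  show "\<forall>\<^sub>F d in sequentially. 2 \<le> enat (hilbert_function J d)"
    using assms by (intro eventually_sequentiallyI[of 2]) (simp add: numeral_eq_enat)
qed

lemma scheme_length_less_2:
  assumes "\<And>d. d \<ge> 2 \<Longrightarrow> hilbert_function J d \<le> 1"
  shows "\<not> 2 \<le> scheme_length J"
proof -
  have "liminf (\<lambda>d. enat (hilbert_function J d)) \<le> liminf (\<lambda>d :: nat. 1 :: enat)"
  proof (rule Liminf_mono)
    show "\<forall>\<^sub>F d in sequentially. enat (hilbert_function J d) \<le> 1"
      using assms by (intro eventually_sequentiallyI[of 2]) (simp add: one_enat_def)
  qed
  also have "\<dots> = 1"
    by (simp add: Liminf_const)
  finally have "scheme_length J \<le> 1"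
    by (simp add: scheme_length_def)
  then show ?thesis
    by (auto simp: not_le intro: le_less_trans)
qed

section \<open>Points, cones and the Zariski topology\<close>

lemma point_exhaust:
  obtains v where "v \<noteq> 0" "p = point v"
proof -
  have p: "vec.subspace (Rep_pspace p)" "vec.dim (Rep_pspace p) = 1"
    using Rep_pspace[of p] by auto
  obtain B where B: "B \<subseteq> Rep_pspace p" "vec.independent B" "Rep_pspace p \<subseteq> vec.span B"
      "card B = vec.dim (Rep_pspace p)"
    using vec.basis_exists by blast
  then obtain v where v: "B = {v}"
    using p(2) by (metis card_1_singletonE)
  then have "Rep_pspace p = vec.span {v}"
    using B p(1) by (metis vec.span_minimal subset_antisym)
  then have "p = point v"
    unfolding point_def by (metis Rep_pspace_inverse)
  moreover have "v \<noteq> 0"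
    using B(2) v vec.dependent_zero by blast
  ultimately show ?thesis
    using that by blast
qed

lemma Rep_point:
  assumes "v \<noteq> 0"
  shows "Rep_pspace (point v) = range (\<lambda>c. c *s v)"
proof -
  have "vec.dim (vec.span {v}) = 1"
    using assms by (simp add: vec.dim_eq_card_independent)
  then show ?thesis
    unfolding point_def
    by (subst Abs_pspace_inverse) (simp_all add: vec.subspace_span, simp add: vec.span_singleton)
qed

lemma point_scale:
  assumes "c \<noteq> 0"
  shows "point (c *s v) = point v"
proof -
  have "v = (1 / c) *s (c *s v)"
    using assms by (simp add: vector_smult_assoc)
  then have "v \<in> vec.span {c *s v}"
    by (metis insertI1 vec.span_base vec.span_scale)
  moreover have "c *s v \<in> vec.span {v}"
    by (simp add: vec.span_base vec.span_scale)
  ultimately have "vec.span {c *s v} = vec.span {v}"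
    by (simp add: vec.span_eq)
  then show ?thesis by (simp add: point_def)
qed

lemma mem_Rep_point: "w \<in> Rep_pspace (point v) \<Longrightarrow> v \<noteq> 0 \<Longrightarrow> w \<noteq> 0 \<Longrightarrow> point w = point v"
  using point_scale by (fastforce simp: Rep_point)

lemma Rep_point_self: "v \<noteq> 0 \<Longrightarrow> v \<in> Rep_pspace (point v)"
  by (auto simp: Rep_point intro: range_eqI[of _ _ 1])

lemma mem_cone_iff: "v \<noteq> 0 \<Longrightarrow> v \<in> cone Z \<longleftrightarrow> point v \<in> Z"
proof
  assume "v \<noteq> 0" "v \<in> cone Z"
  then obtain p where "p \<in> Z" "v \<in> Rep_pspace p"
    by (auto simp: cone_def)
  then show "point v \<in> Z"
    using \<open>v \<noteq> 0\<close> by (metis mem_Rep_point point_exhaust)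
qed (auto simp: cone_def intro: Rep_point_self)

lemma zero_in_cone [simp]: "0 \<in> cone Z"
  by (simp add: cone_def)

lemma cone_scale: "v \<in> cone Z \<Longrightarrow> c *s v \<in> cone Z"
  by (cases "c = 0 \<or> v = 0") (auto simp: mem_cone_iff point_scale)

lemma Rep_pspace_subset_cone: "p \<in> Z \<Longrightarrow> Rep_pspace p \<subseteq> cone Z"
  by (auto simp: cone_def)

lemma linear_subspaceE:
  assumes "linear_subspace Z"
  shows "vec.subspace (cone Z)" and "Z = {p. Rep_pspace p \<subseteq> cone Z}"
proof -
  obtain W where W: "vec.subspace W" "Z = {p. Rep_pspace p \<subseteq> W}"
    using assms by (auto simp: linear_subspace_def)
  have "v \<in> cone Z \<longleftrightarrow> v \<in> W" for v
  proof (cases "v = 0")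
    case False
    have "Rep_pspace (point v) \<subseteq> W \<longleftrightarrow> v \<in> W"
      using Rep_point_self[OF False] W(1) by (auto simp: Rep_point[OF False] vec.subspace_scale)
    then show ?thesis
      using False by (simp add: mem_cone_iff W(2))
  qed (use W(1) in \<open>simp add: vec.subspace_0\<close>)
  then have "cone Z = W" by blast
  with W show "vec.subspace (cone Z)" "Z = {p. Rep_pspace p \<subseteq> cone Z}"
    by auto
qed

lemma proj_map_point:
  assumes "L *v v \<noteq> 0"
  shows "proj_map L (point v) = point (L *v v)"
proof -
  have "v \<noteq> 0" using assms by auto
  then have "(*v) L ` Rep_pspace (point v) = range (\<lambda>c. c *s (L *v v))"
    by (simp add: Rep_point image_image vector_scalar_commute)
  also have "\<dots> = Rep_pspace (point (L *v v))"
    using assms by (simp add: Rep_point)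
  finally show ?thesis
    by (simp add: proj_map_def Rep_pspace_inverse)
qed

definition nonvanishing :: "('k::field^'n::finite \<Rightarrow> 'k) \<Rightarrow> ('k, 'n) pspace set" where
  "nonvanishing f = {p. \<exists>v\<in>Rep_pspace p. f v \<noteq> 0}"

lemma point_in_nonvanishing_iff:
  assumes "form d f" "v \<noteq> 0"
  shows "point v \<in> nonvanishing f \<longleftrightarrow> f v \<noteq> 0"
  using assms form_scaling[OF assms(1)]
  by (auto simp: nonvanishing_def Rep_point intro: exI[of _ 1])

text \<open>
  The nonvanishing sets of forms are closed under finite intersections, because the product of two
  forms is a form; so they are a basis and not only a subbasis.
\<close>

lemma zariski_basis:
  assumes "openin zariski U" "p \<in> U"
  obtains d f where "0 < d" "form d f" "p \<in> nonvanishing f" "nonvanishing f \<subseteq> U"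
proof -
  have "generate_topology_on {{p. \<exists>v\<in>Rep_pspace p. poly_eval F v \<noteq> 0} | F d. homogeneous d F \<and> 0 < d} U"
    using assms(1) unfolding zariski_def by (rule openin_topology_generated_by)
  then have "\<forall>p\<in>U. \<exists>d f. 0 < d \<and> form d f \<and> p \<in> nonvanishing f \<and> nonvanishing f \<subseteq> U"
  proof (induction rule: generate_topology_on.induct)
    case (Int a b)
    show ?case
    proof
      fix p assume "p \<in> a \<inter> b"
      then obtain d f e g where fg: "0 < d" "form d f" "p \<in> nonvanishing f" "nonvanishing f \<subseteq> a"
        "0 < e" "form e g" "p \<in> nonvanishing g" "nonvanishing g \<subseteq> b"
        using Int.IH by blast
      have fm: "form (d + e) (\<lambda>v. f v * g v)"
        using fg by (intro form_mult)
      have "nonvanishing (\<lambda>v. f v * g v) = nonvanishing f \<inter> nonvanishing g"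
      proof (rule set_eqI)
        fix x :: "('a, 'b) pspace"
        obtain v where v: "v \<noteq> 0" "x = point v" using point_exhaust .
        show "x \<in> nonvanishing (\<lambda>v. f v * g v) \<longleftrightarrow> x \<in> nonvanishing f \<inter> nonvanishing g"
          using v fg fm by (simp add: point_in_nonvanishing_iff)
      qed
      with fg fm show "\<exists>d f. 0 < d \<and> form d f \<and> p \<in> nonvanishing f \<and> nonvanishing f \<subseteq> a \<inter> b"
        by (intro exI[of _ "d + e"] exI[of _ "\<lambda>v. f v * g v"]) auto
    qed
  next
    case (UN K)
    show ?case
    proof
      fix p assume "p \<in> \<Union>K"
      then obtain k where k: "k \<in> K" "p \<in> k" by blast
      then obtain d f where "0 < d" "form d f" "p \<in> nonvanishing f" "nonvanishing f \<subseteq> k"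
        using UN.IH by blast
      then show "\<exists>d f. 0 < d \<and> form d f \<and> p \<in> nonvanishing f \<and> nonvanishing f \<subseteq> \<Union>K"
        using k(1) by (intro exI[of _ d] exI[of _ f]) auto
    qed
  next
    case (Basis s)
    then obtain F d where "s = nonvanishing (poly_eval F)" "homogeneous d F" "0 < d"
      unfolding nonvanishing_def by blast
    then show ?case
      using form_poly_eval by blast
  qed auto
  with assms(2) that show thesis by blast
qed

lemma topspace_zariski [simp]: "topspace zariski = UNIV"
proof -
  have "p \<in> topspace zariski" for p :: "('k::field, 'n::finite) pspace"
  proof -
    obtain v where v: "v \<noteq> 0" "p = point v" using point_exhaust .
    then obtain i where i: "v $ i \<noteq> 0" by (metis vec_eq_iff zero_index)
    obtain F where "homogeneous 1 F" "(\<lambda>v :: 'k^'n. v $ i) = poly_eval F"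
      using form_coordinate[of i] unfolding form_def by blast
    then have "p \<in> {p. \<exists>v\<in>Rep_pspace p. poly_eval F v \<noteq> 0}"
      using v i Rep_point_self[OF v(1)] by (auto simp: fun_eq_iff)
    moreover have "{p. \<exists>v\<in>Rep_pspace p. poly_eval F v \<noteq> 0} \<subseteq> topspace zariski"
      unfolding zariski_def by (intro openin_subset topology_generated_by_Basis)
        (use \<open>homogeneous 1 F\<close> zero_less_one in blast)
    ultimately show ?thesis by blast
  qed
  then show ?thesis by blast
qed

lemma openin_zariski_UNIV [simp]: "openin zariski UNIV"
  by (metis openin_topspace topspace_zariski)

lemma openin_nonvanishing:
  assumes "form d f"
  shows "openin zariski (nonvanishing f)"
proof -
  consider "0 < d" | "f = (\<lambda>v. 0)" | "d = 0" using form_negative[OF assms] by linarith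
  then show ?thesis
  proof cases
    case 1
    then show ?thesis
      using assms unfolding zariski_def form_def nonvanishing_def
      by (intro topology_generated_by_Basis) blast
  next
    case 2
    then show ?thesis by (simp add: nonvanishing_def)
  next
    case 3
    have "f v = f 0" for v
      using form_degree_0[OF assms 3] .
    then have "nonvanishing f = (if f 0 = 0 then {} else UNIV)"
      by (auto simp: nonvanishing_def) (metis point_exhaust Rep_point_self)
    then show ?thesis by simp
  qed
qed

text \<open>A closed set is cut out by the forms that vanish on it.\<close>

lemma closedin_zariski_separation:
  assumes "closedin zariski Z" "p \<notin> Z"
  obtains d f where "0 < d" "form d f" "\<And>v. v \<in> cone Z \<Longrightarrow> f v = 0" "p \<in> nonvanishing f"
proof -
  have "openin zariski (- Z)"
    using assms(1) by (simp add: closedin_def Compl_eq_Diff_UNIV)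
  then obtain d f where f: "0 < d" "form d f" "p \<in> nonvanishing f" "nonvanishing f \<subseteq> - Z"
    using zariski_basis assms(2) by (metis ComplI)
  have "f v = 0" if "v \<in> cone Z" for v
  proof (cases "v = 0")
    case False
    then show ?thesis
      using f that by (metis Compl_iff mem_cone_iff point_in_nonvanishing_iff subsetD)
  qed (use f form_at_0 in auto)
  with f that show thesis by blast
qed

lemma closedin_vanishing:
  assumes "form d f"
  shows "closedin zariski (- nonvanishing f)"
  using openin_nonvanishing[OF assms] by (simp add: closedin_def Compl_eq_Diff_UNIV double_diff)

section \<open>Regular functions and morphisms given by forms\<close>

lemma restr_cone_form_in_twist_sections:
  assumes "form j f"
  shows "restr_cone Z f \<in> twist_sections j Z"
proof -
  obtain F where F: "homogeneous j F" "f = poly_eval F"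
    using assms by (auto simp: form_def)
  have "\<exists>U F G d. openin zariski U \<and> p \<in> U \<and> homogeneous (d + j) F \<and> homogeneous d G \<and>
      (\<forall>v\<in>cone (Z \<inter> U) - {0}. poly_eval G v \<noteq> 0 \<and> restr_cone Z f v = poly_eval F v / poly_eval G v)"
    if "p \<in> Z" for p
  proof -
    obtain G where "homogeneous 0 G" "(\<lambda>v :: 'a^'b. 1) = poly_eval G"
      using form_const[of 1] unfolding form_def by blast
    then have "homogeneous 0 G" "\<And>v. poly_eval G v = 1"
      by (simp_all add: fun_eq_iff)
    then show ?thesis
      using F by (intro exI[of _ UNIV] exI[of _ F] exI[of _ G] exI[of _ "0 :: int"])
        (simp add: restr_cone_def restr_def)
  qed
  then show ?thesis
    by (auto simp: twist_sections_def restr_cone_def restr_def)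
qed

text \<open>These sections witness that \<open>\<O>(-1)\<close> is nonzero near every point of \<open>Z\<close>.\<close>

lemma inverse_coordinate_in_twist_sections:
  fixes Z :: "('k::field, 'n::finite) pspace set"
  assumes "Z \<subseteq> nonvanishing (\<lambda>v. v $ i)"
  shows "restr_cone Z (\<lambda>v. 1 / v $ i) \<in> twist_sections (-1) Z"
proof -
  obtain F where F: "homogeneous (1 + - 1) F" "\<And>v :: 'k^'n. poly_eval F v = 1"
    using form_const[of 1] unfolding form_def by (metis add.right_inverse)
  obtain G where G: "homogeneous 1 G" "\<And>v :: 'k^'n. poly_eval G v = v $ i"
    using form_coordinate[of i] unfolding form_def by metis
  have "v $ i \<noteq> 0" if "v \<in> cone Z - {0}" for v
    using that assms point_in_nonvanishing_iff[OF form_coordinate[of i], of v]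
    by (auto simp: mem_cone_iff)
  then have "\<forall>v\<in>cone (Z \<inter> UNIV) - {0}. poly_eval G v \<noteq> 0 \<and>
      restr_cone Z (\<lambda>v. 1 / v $ i) v = poly_eval F v / poly_eval G v"
    by (simp add: F(2) G(2) restr_cone_def restr_def)
  then have "\<exists>U F G d. openin zariski U \<and> p \<in> U \<and> homogeneous (d + - 1) F \<and> homogeneous d G \<and>
      (\<forall>v\<in>cone (Z \<inter> U) - {0}. poly_eval G v \<noteq> 0 \<and>
        restr_cone Z (\<lambda>v. 1 / v $ i) v = poly_eval F v / poly_eval G v)" for p
    using F(1) G(1) openin_zariski_UNIV UNIV_I by blast
  then show ?thesis
    by (simp add: twist_sections_def) (simp add: restr_cone_def restr_def)
qed

lemma regular_iff:
  "s \<in> regular Z \<longleftrightarrow> (\<forall>p. p \<notin> Z \<longrightarrow> s p = 0) \<and>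
     (\<forall>p\<in>Z. \<exists>U F G d. openin zariski U \<and> p \<in> U \<and> form d F \<and> form d G \<and>
        (\<forall>v. v \<noteq> 0 \<longrightarrow> point v \<in> Z \<inter> U \<longrightarrow> G v \<noteq> 0 \<and> s (point v) = F v / G v))"
    (is "_ \<longleftrightarrow> ?zero \<and> (\<forall>p\<in>Z. ?loc p)")
proof -
  have punctured: "cone S - {0} = {v. v \<noteq> 0 \<and> point v \<in> S}" for S :: "('a, 'b) pspace set"
    using mem_cone_iff by blast
  have loc: "(\<exists>U F G d. openin zariski U \<and> p \<in> U \<and> homogeneous (d + 0) F \<and> homogeneous d G \<and>
        (\<forall>v\<in>cone (Z \<inter> U) - {0}. poly_eval G v \<noteq> 0 \<and>
          (if v = 0 then 0 else s (point v)) = poly_eval F v / poly_eval G v)) \<longleftrightarrow> ?loc p"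
    (is "?lhs \<longleftrightarrow> _") if "p \<in> Z" for p
  proof
    assume ?lhs
    then obtain U F G d where "openin zariski U" "p \<in> U" "homogeneous d F" "homogeneous d G"
      "\<forall>v. v \<noteq> 0 \<longrightarrow> point v \<in> Z \<inter> U \<longrightarrow> poly_eval G v \<noteq> 0 \<and> s (point v) = poly_eval F v / poly_eval G v"
      by (auto simp: punctured)
    then show "?loc p"
      using form_poly_eval by blast
  next
    assume "?loc p"
    then obtain U F G d where "openin zariski U" "p \<in> U" "homogeneous d F" "homogeneous d G"
      "\<forall>v. v \<noteq> 0 \<longrightarrow> point v \<in> Z \<inter> U \<longrightarrow> poly_eval G v \<noteq> 0 \<and> s (point v) = poly_eval F v / poly_eval G v"
      unfolding form_def by blast
    then show ?lhs
      by (intro exI[of _ U] exI[of _ F] exI[of _ G] exI[of _ d]) (simp add: punctured)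
  qed
  have eq: "s \<in> regular Z \<longleftrightarrow> ?zero \<and>
      (\<forall>v. v \<notin> cone Z - {0} \<longrightarrow> (if v = 0 then 0 else s (point v)) = 0) \<and> (\<forall>p\<in>Z. ?loc p)"
    by (simp only: regular_def twist_sections_def mem_Collect_eq loc cong: ball_cong)
  have imp: "(\<forall>v. v \<notin> cone Z - {0} \<longrightarrow> (if v = 0 then 0 else s (point v)) = 0)"
    if ?zero
    using that by (simp add: punctured)
  have logic: "(a \<longleftrightarrow> z \<and> c \<and> l) \<Longrightarrow> (z \<Longrightarrow> c) \<Longrightarrow> (a \<longleftrightarrow> z \<and> l)" for a z c l :: bool
    by blast
  show ?thesis
    by (rule logic[OF eq imp])
qed

lemma preimage_open_of_forms:
  fixes \<Phi> :: "'k::field^'n::finite \<Rightarrow> 'k^'m::finite"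
  assumes \<Phi>: "\<And>i. form e (\<lambda>v. \<Phi> v $ i)"
    and f: "\<And>v. v \<noteq> 0 \<Longrightarrow> point v \<in> Y \<Longrightarrow> \<Phi> v \<noteq> 0 \<and> f (point v) = point (\<Phi> v)"
    and U: "openin zariski U"
  obtains U' where "openin zariski U'" "\<And>p. p \<in> Y \<Longrightarrow> p \<in> U' \<longleftrightarrow> f p \<in> U"
proof -
  define U' where "U' = \<Union>{nonvanishing (\<lambda>v. g (\<Phi> v)) | g d. form d g \<and> nonvanishing g \<subseteq> U}"
  have "openin zariski U'"
    unfolding U'_def using form_compose[OF _ \<Phi>] openin_nonvanishing
    by (intro openin_Union) blast
  moreover have "p \<in> U' \<longleftrightarrow> f p \<in> U" if "p \<in> Y" for p
  proof -
    obtain v where v: "v \<noteq> 0" "p = point v" using point_exhaust .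
    have fv: "\<Phi> v \<noteq> 0" "f p = point (\<Phi> v)"
      using f v that by auto
    have mem: "p \<in> nonvanishing (\<lambda>v. g (\<Phi> v)) \<longleftrightarrow> f p \<in> nonvanishing g" if "form d g" for d g
      using that v fv form_compose[OF that \<Phi>] by (simp add: point_in_nonvanishing_iff)
    show ?thesis
    proof
      assume "p \<in> U'"
      then show "f p \<in> U"
        using mem unfolding U'_def by blast
    next
      assume "f p \<in> U"
      then obtain d g where "form d g" "f p \<in> nonvanishing g" "nonvanishing g \<subseteq> U"
        using zariski_basis[OF U] by metis
      then show "p \<in> U'"
        using mem unfolding U'_def by blast
    qed
  qed
  ultimately show thesis using that by blast
qed

text \<open>
  A tuple of forms of the same degree without common zeros on \<open>Y\<close> defines a morphism: pulling back
  along it turns forms into forms, hence open sets into open sets and fractions into fractions.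
\<close>

lemma morphism_of_forms:
  fixes \<Phi> :: "'k::field^'n::finite \<Rightarrow> 'k^'m::finite"
  assumes \<Phi>: "\<And>i. form e (\<lambda>v. \<Phi> v $ i)"
    and f: "\<And>v. v \<noteq> 0 \<Longrightarrow> point v \<in> Y \<Longrightarrow> \<Phi> v \<noteq> 0 \<and> f (point v) = point (\<Phi> v)"
    and im: "f ` Y \<subseteq> Z"
  shows "morphism_of_varieties Y Z f"
  unfolding morphism_of_varieties_def
proof (intro conjI allI impI ballI)
  show "continuous_map (subtopology zariski Y) (subtopology zariski Z) f"
    unfolding continuous_map_def
  proof (intro conjI allI impI)
    fix U assume "openin (subtopology zariski Z) U"
    then obtain V where V: "openin zariski V" "U = V \<inter> Z"
      by (auto simp: openin_subtopology)
    obtain V' where V': "openin zariski V'" "\<And>p. p \<in> Y \<Longrightarrow> p \<in> V' \<longleftrightarrow> f p \<in> V"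
      using preimage_open_of_forms[OF \<Phi> f V(1)] by metis
    have "{p \<in> topspace (subtopology zariski Y). f p \<in> U} = V' \<inter> Y"
      using V' V(2) im by auto
    then show "openin (subtopology zariski Y) {p \<in> topspace (subtopology zariski Y). f p \<in> U}"
      using V'(1) by (auto simp: openin_subtopology)
  qed (use im in auto)
next
  fix V s assume V: "openin zariski V" and s: "s \<in> regular (Z \<inter> V)"
  show "restr (Y \<inter> f -` V) (s \<circ> f) \<in> regular (Y \<inter> f -` V)"
    unfolding regular_iff
  proof (intro conjI allI impI ballI)
    fix p assume p: "p \<in> Y \<inter> f -` V"
    then have "f p \<in> Z \<inter> V" using im by auto
    then obtain U F G d where U: "openin zariski U" "f p \<in> U" "form d F" "form d G"
      "\<And>v. v \<noteq> 0 \<Longrightarrow> point v \<in> Z \<inter> V \<inter> U \<Longrightarrow> G v \<noteq> 0 \<and> s (point v) = F v / G v"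
      using s unfolding regular_iff by metis
    obtain U' where U': "openin zariski U'" "\<And>p. p \<in> Y \<Longrightarrow> p \<in> U' \<longleftrightarrow> f p \<in> U"
      using preimage_open_of_forms[OF \<Phi> f U(1)] by metis
    have "G (\<Phi> v) \<noteq> 0 \<and> restr (Y \<inter> f -` V) (s \<circ> f) (point v) = F (\<Phi> v) / G (\<Phi> v)"
      if v: "v \<noteq> 0" "point v \<in> Y \<inter> f -` V \<inter> U'" for v
    proof -
      have "\<Phi> v \<noteq> 0" "f (point v) = point (\<Phi> v)"
        using f v by auto
      moreover have "point (\<Phi> v) \<in> Z \<inter> V \<inter> U"
        using calculation v im U'(2) by fastforce
      ultimately show ?thesis
        using U(5)[of "\<Phi> v"] v by (simp add: restr_def)
    qed
    then show "\<exists>U F G d. openin zariski U \<and> p \<in> U \<and> form d F \<and> form d G \<and>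
        (\<forall>v. v \<noteq> 0 \<longrightarrow> point v \<in> Y \<inter> f -` V \<inter> U \<longrightarrow>
           G v \<noteq> 0 \<and> restr (Y \<inter> f -` V) (s \<circ> f) (point v) = F v / G v)"
      using U'(1) U'(2)[of p] p U(2) form_compose[OF U(3) \<Phi>] form_compose[OF U(4) \<Phi>]
      by (intro exI[of _ U'] exI[of _ "\<lambda>v. F (\<Phi> v)"] exI[of _ "\<lambda>v. G (\<Phi> v)"] exI[of _ "d * e"]) auto
  qed (auto simp: restr_def)
qed

text \<open>The point \<open>point (\<Phi> v)\<close> depends only on \<open>point v\<close>, as \<open>\<Phi> (c *s v) = c ^ e *s \<Phi> v\<close>.\<close>

lemma map_of_forms:
  fixes \<Phi> :: "'k::field^'n::finite \<Rightarrow> 'k^'m::finite"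
  assumes "\<And>i. form e (\<lambda>v. \<Phi> v $ i)"
  obtains f where "\<And>v. v \<noteq> 0 \<Longrightarrow> f (point v) = point (\<Phi> v)"
proof -
  define rep where "rep p = (SOME v :: 'k^'n. v \<noteq> 0 \<and> p = point v)" for p
  have "point (\<Phi> (rep (point v))) = point (\<Phi> v)" if v: "v \<noteq> 0" for v
  proof -
    have rep: "rep (point v) \<noteq> 0 \<and> point v = point (rep (point v))"
      unfolding rep_def using v by (intro someI[of "\<lambda>w. w \<noteq> 0 \<and> point v = point w" v]) auto
    then have "rep (point v) \<in> Rep_pspace (point v)"
      using Rep_point_self by metis
    then obtain c where c: "rep (point v) = c *s v"
      unfolding Rep_point[OF v] by blast
    then have "c \<noteq> 0"
      using rep by auto
    moreover have "\<Phi> (c *s v) = c ^ nat e *s \<Phi> v"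
      using form_scaling[OF assms] by (simp add: vec_eq_iff)
    ultimately show ?thesis
      by (simp add: c point_scale)
  qed
  then show thesis
    using that[of "\<lambda>p. point (\<Phi> (rep p))"] by blast
qed

section \<open>Coordinates adapted to a projection\<close>

text \<open>
  A lift \<open>B\<close> of the target to the source splits the projection and identifies the source with
  pairs \<open>(\<xi> v, L *v v)\<close>. The vector \<open>q0\<close> spans the centre.
\<close>

locale split_projection =
  fixes L :: "'k::alg_closed_field^'n::finite^'m::finite"
    and q0 :: "'k^'n" and B :: "'k^'m^'n" and \<xi> :: "'k^'n \<Rightarrow> 'k"
  assumes L_q0: "L *v q0 = 0" and q0_nonzero: "q0 \<noteq> 0"
    and L_B: "L *v (B *v y) = y"
    and decomposition: "v = \<xi> v *s q0 + B *v (L *v v)"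
    and form_\<xi>: "form 1 \<xi>"
begin

lemma L_combination: "L *v (a *s q0 + B *v y) = y"
  by (simp add: matrix_vector_right_distrib vector_scalar_commute L_q0 L_B)

lemma \<xi>_combination: "\<xi> (a *s q0 + B *v y) = a"
proof -
  have "a *s q0 + B *v y = \<xi> (a *s q0 + B *v y) *s q0 + B *v y"
    using decomposition[of "a *s q0 + B *v y"] by (simp add: L_combination)
  then have "(a - \<xi> (a *s q0 + B *v y)) *s q0 = 0"
    by (simp add: vector_sub_rdistrib)
  then show ?thesis
    using q0_nonzero by (simp add: vector_mul_eq_0)
qed

lemma \<xi>_q0: "\<xi> q0 = 1"
  using \<xi>_combination[of 1 0] by simp

lemma L_scale: "L *v (c *s v) = c *s (L *v v)"
  by (simp add: vector_scalar_commute)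

lemma cone_cone_over:
  assumes "linear_subspace Z"
  shows "linear_subspace (cone_over L Z)" and "v \<in> cone (cone_over L Z) \<longleftrightarrow> L *v v \<in> cone Z"
proof -
  have W: "vec.subspace (cone Z)"
    using linear_subspaceE(1)[OF assms] .
  have "vec.subspace {v. L *v v \<in> cone Z}"
    unfolding vec.subspace_def
    using W by (auto simp: matrix_vector_right_distrib L_scale cone_scale vec.subspace_add)
  moreover have eq: "cone_over L Z = {x. Rep_pspace x \<subseteq> {v. L *v v \<in> cone Z}}"
    by (auto simp: cone_over_def)
  ultimately show "linear_subspace (cone_over L Z)"
    unfolding linear_subspace_def by blast
  show "v \<in> cone (cone_over L Z) \<longleftrightarrow> L *v v \<in> cone Z"
  proof (cases "v = 0")
    case False
    have "Rep_pspace (point v) \<subseteq> {v. L *v v \<in> cone Z} \<longleftrightarrow> L *v v \<in> cone Z"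
      using Rep_point_self[OF False] by (auto simp: Rep_point[OF False] L_scale cone_scale)
    then show ?thesis
      using False by (simp add: mem_cone_iff eq)
  qed simp
qed

end

section \<open>The quadric relation\<close>

text \<open>
  The last two assumptions say that the forms vanishing on \<open>\<Lambda>\<close> are exactly the forms \<open>G\<close> on
  the target for which \<open>G \<xi>\<close> is, on \<open>X\<close>, pulled back from the target: \<open>I\<^sub>\<Lambda>\<close> is the conductor of
  \<open>S\<^bsub>X\<^sub>q\<^esub>\<close> in \<open>E\<close>.
\<close>

locale conductor_data = split_projection L q0 B \<xi>
  for L :: "'k::alg_closed_field^'n::finite^'m::finite" and q0 B \<xi> +
  fixes X :: "('k, 'n) pspace set" and \<Lambda> :: "('k, 'm) pspace set"
    and \<beta> \<gamma> :: "'k^'m \<Rightarrow> 'k"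
  assumes closed_X: "closedin zariski X"
    and L_nonzero: "v \<in> cone X \<Longrightarrow> v \<noteq> 0 \<Longrightarrow> L *v v \<noteq> 0"
    and linear_\<Lambda>: "linear_subspace \<Lambda>"
    and form_\<beta>: "form 1 \<beta>" and form_\<gamma>: "form 2 \<gamma>"
    and quadratic_relation: "v \<in> cone X \<Longrightarrow> \<xi> v ^ 2 + \<beta> (L *v v) * \<xi> v + \<gamma> (L *v v) = 0"
    and conductor_vanishes: "form (d - 1) G \<Longrightarrow> form d H \<Longrightarrow>
      (\<And>v. v \<in> cone X \<Longrightarrow> G (L *v v) * \<xi> v + H (L *v v) = 0) \<Longrightarrow> y \<in> cone \<Lambda> \<Longrightarrow> G y = 0"
    and conductor_contains: "form (d - 1) G \<Longrightarrow> (\<And>y. y \<in> cone \<Lambda> \<Longrightarrow> G y = 0) \<Longrightarrow>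
      \<exists>H. form d H \<and> (\<forall>v\<in>cone X. G (L *v v) * \<xi> v = H (L *v v))"
begin

definition quad :: "'k^'n \<Rightarrow> 'k" where
  "quad v = \<xi> v ^ 2 + \<beta> (L *v v) * \<xi> v + \<gamma> (L *v v)"

lemma form_quad: "form 2 quad"
proof -
  have "form (int 2 * 1) (\<lambda>v. \<xi> v ^ 2)"
    using form_\<xi> by (rule form_power)
  moreover have "form (1 + 1) (\<lambda>v. \<beta> (L *v v) * \<xi> v)"
    using form_\<beta> form_\<xi> by (intro form_mult form_compose_matrix)
  moreover have "form 2 (\<lambda>v. \<gamma> (L *v v))"
    using form_\<gamma> by (rule form_compose_matrix)
  ultimately show ?thesis
    unfolding quad_def by (auto intro: form_add)
qed

lemma quad_combination: "quad (a *s q0 + B *v y) = a ^ 2 + \<beta> y * a + \<gamma> y"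
  by (simp add: quad_def \<xi>_combination L_combination)

lemma quad_q0: "quad q0 = 1"
  using quad_combination[of 1 0] form_at_0[OF form_\<beta>] form_at_0[OF form_\<gamma>] by simp

text \<open>
  Division with remainder by \<open>quad\<close>, which is monic in \<open>\<xi>\<close>. Multiplication by a coordinate
  \<open>c \<xi> + b\<close> creates one term \<open>c G \<xi>\<^sup>2\<close>, which is reduced by \<open>\<xi>\<^sup>2 = quad - \<beta> \<xi> - \<gamma>\<close>.
\<close>

lemma division_by_quad:
  assumes "form d F"
  shows "\<exists>A G H. form (d - 2) A \<and> form (d - 1) G \<and> form d H \<and>
    (\<forall>v. F v = A v * quad v + G (L *v v) * \<xi> v + H (L *v v))"
  using assms
proof (induction rule: form_induct)
  case (const c)
  show ?case
    by (intro exI[of _ "\<lambda>v. 0"] exI[of _ "\<lambda>v. c"]) (simp add: form_0 form_const)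
next
  case (zero d)
  show ?case
    by (intro exI[of _ "\<lambda>v. 0"]) (simp add: form_0)
next
  case (add d F F')
  then obtain A G H A' G' H' where "form (d - 2) A" "form (d - 1) G" "form d H"
    "\<And>v. F v = A v * quad v + G (L *v v) * \<xi> v + H (L *v v)"
    "form (d - 2) A'" "form (d - 1) G'" "form d H'"
    "\<And>v. F' v = A' v * quad v + G' (L *v v) * \<xi> v + H' (L *v v)"
    by metis
  then show ?case
    by (intro exI[of _ "\<lambda>v. A v + A' v"] exI[of _ "\<lambda>v. G v + G' v"] exI[of _ "\<lambda>v. H v + H' v"]
      conjI allI form_add) (simp_all only: distrib_right add_ac)
next
  case (coordinate d F i)
  then obtain A G H where AGH: "form (d - 2) A" "form (d - 1) G" "form d H"
    "\<And>v. F v = A v * quad v + G (L *v v) * \<xi> v + H (L *v v)"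
    by metis
  define b where "b = (\<lambda>y. (B *v y) $ i)"
  define c where "c = q0 $ i"
  have b: "form 1 b"
    unfolding b_def by (rule form_matrix)
  have v: "v $ i = c * \<xi> v + b (L *v v)" for v
    using arg_cong[OF decomposition[of v], of "\<lambda>w. w $ i"] by (simp add: b_def c_def)
  define A' G' H' where "A' = (\<lambda>v. v $ i * A v + c * G (L *v v))"
    and "G' = (\<lambda>y. b y * G y + c * H y - c * (\<beta> y * G y))"
    and "H' = (\<lambda>y. b y * H y - c * (\<gamma> y * G y))"
  have "form (1 + d - 2) A'"
    using form_mult[OF form_coordinate[of i] AGH(1)] form_cmult[OF form_compose_matrix[OF AGH(2)], of c L]
    unfolding A'_def by (intro form_add) (simp_all add: add_diff_eq)
  moreover have "form (1 + d - 1) G'"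
    using form_mult[OF b AGH(2)] form_cmult[OF AGH(3), of c] form_cmult[OF form_mult[OF form_\<beta> AGH(2)], of c]
    unfolding G'_def by (intro form_add form_diff) simp_all
  moreover have "form (1 + d) H'"
    using form_mult[OF b AGH(3)] form_cmult[OF form_mult[OF form_\<gamma> AGH(2)], of c]
    unfolding H'_def by (intro form_diff) simp_all
  moreover have "v $ i * F v = A' v * quad v + G' (L *v v) * \<xi> v + H' (L *v v)" for v
  proof -
    have "(c * x + b) * (A * (x ^ 2 + \<beta> * x + \<gamma>) + G * x + H) =
        ((c * x + b) * A + c * G) * (x ^ 2 + \<beta> * x + \<gamma>) +
        (b * G + c * H - c * (\<beta> * G)) * x + (b * H - c * (\<gamma> * G))" for c x b A \<beta> \<gamma> G H :: 'k
      by algebra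
    then show ?thesis
      by (simp only: AGH(4) A'_def G'_def H'_def quad_def v)
  qed
  ultimately show ?case by blast
qed

text \<open>
  The remainder \<open>G \<xi> + H\<close> vanishes on \<open>X\<close>, hence \<open>G\<close> vanishes on \<open>\<Lambda>\<close>. Its product with \<open>\<xi>\<close> reduces to
  \<open>(H - \<beta> G) \<xi> - \<gamma> G\<close>, which vanishes on \<open>X\<close> as well, hence so does \<open>H - \<beta> G\<close> on \<open>\<Lambda>\<close>.
\<close>

lemma vanishing_form_is_multiple_of_quad:
  assumes "form d F" "\<And>v. v \<in> cone X \<Longrightarrow> F v = 0"
  shows "\<exists>A. form (d - 2) A \<and> (\<forall>v. L *v v \<in> cone \<Lambda> \<longrightarrow> F v = A v * quad v)"
proof -
  obtain A G H where AGH: "form (d - 2) A" "form (d - 1) G" "form d H"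
    "\<And>v. F v = A v * quad v + G (L *v v) * \<xi> v + H (L *v v)"
    using division_by_quad[OF assms(1)] by blast
  have relation: "G (L *v v) * \<xi> v + H (L *v v) = 0" if "v \<in> cone X" for v
    using AGH(4)[of v] assms(2)[OF that] quadratic_relation[OF that] by (simp add: quad_def)
  have G: "G y = 0" if "y \<in> cone \<Lambda>" for y
    using conductor_vanishes[OF AGH(2,3) relation that] .
  have forms: "form (d + 1 - 1) (\<lambda>y. H y - \<beta> y * G y)" "form (d + 1) (\<lambda>y. - (\<gamma> y * G y))"
    using form_mult[OF form_\<beta> AGH(2)] form_mult[OF form_\<gamma> AGH(2)] AGH(3)
    by (intro form_diff form_uminus; simp add: algebra_simps)+
  have "(H (L *v v) - \<beta> (L *v v) * G (L *v v)) * \<xi> v + - (\<gamma> (L *v v) * G (L *v v)) = 0"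
    if "v \<in> cone X" for v
  proof -
    have "(H (L *v v) - \<beta> (L *v v) * G (L *v v)) * \<xi> v + - (\<gamma> (L *v v) * G (L *v v)) =
        \<xi> v * (G (L *v v) * \<xi> v + H (L *v v)) - G (L *v v) * quad v"
      unfolding quad_def by algebra
    then show ?thesis
      using relation[OF that] quadratic_relation[OF that] by (simp add: quad_def)
  qed
  then have "H y - \<beta> y * G y = 0" if "y \<in> cone \<Lambda>" for y
    using conductor_vanishes[OF forms _ that] by blast
  then have "F v = A v * quad v" if "L *v v \<in> cone \<Lambda>" for v
    using G that by (simp add: AGH(4))
  then show ?thesis using AGH(1) by blast
qed

text \<open>The homogeneous components are treated one by one.\<close>

lemma vanishing_polynomial_is_multiple_of_quad:
  assumes "F \<in> vanishing_ideal X"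
  shows "\<exists>A. \<forall>v. L *v v \<in> cone \<Lambda> \<longrightarrow> poly_eval F v = poly_eval A v * quad v"
proof -
  obtain N g where g: "\<And>j. form (int j) (g j)" "poly_eval F = (\<lambda>v. \<Sum>j<N. g j v)"
    "\<And>v j. (\<And>c. poly_eval F (c *s v) = 0) \<Longrightarrow> j < N \<Longrightarrow> g j v = 0"
    using poly_eval_homogeneous_components[of F] by metis
  have "g j v = 0" if "j < N" "v \<in> cone X" for j v
    using g(3)[of v j] assms that by (simp add: vanishing_ideal_def cone_scale)
  then have "\<exists>A. \<forall>v. L *v v \<in> cone \<Lambda> \<longrightarrow> g j v = poly_eval A v * quad v" if "j < N" for j
    using vanishing_form_is_multiple_of_quad[OF g(1)] that unfolding form_def by metis
  then obtain A where "\<And>j v. j < N \<Longrightarrow> L *v v \<in> cone \<Lambda> \<Longrightarrow> g j v = poly_eval (A j) v * quad v"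
    by metis
  then show ?thesis
    by (intro exI[of _ "\<Sum>j<N. A j"]) (simp add: g(2) poly_eval_sum sum_distrib_right)
qed

text \<open>
  The two ideals already agree before saturation: modulo the ideal of \<open>\<langle>q, \<Lambda>\<rangle>\<close> every element of the
  ideal of \<open>X\<close> is a multiple of \<open>quad\<close>, and \<open>quad\<close> is one of them. It is not zero at \<open>q\<close>.
\<close>

lemma quadric_in_cone_over:
  "quadric_in (cone_over L \<Lambda>) (ideal.span (vanishing_ideal X \<union> vanishing_ideal (cone_over L \<Lambda>)))"
proof -
  let ?I = "vanishing_ideal (cone_over L \<Lambda>)"
  note cone = cone_cone_over[OF linear_\<Lambda>]
  obtain Q where Q: "homogeneous 2 Q" "quad = poly_eval Q"
    using form_quad unfolding form_def by blast
  have "Q \<in> vanishing_ideal X"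
    using quadratic_relation by (simp add: vanishing_ideal_def quad_def flip: Q(2))
  then have "ideal.span (insert Q ?I) \<subseteq> ideal.span (vanishing_ideal X \<union> ?I)"
    by (intro ideal.span_mono) auto
  moreover have "ideal.span (vanishing_ideal X \<union> ?I) \<subseteq> ideal.span (insert Q ?I)"
  proof (rule ideal.span_minimal)
    have "F \<in> ideal.span (insert Q ?I)" if F: "F \<in> vanishing_ideal X" for F
    proof -
      obtain A where "\<And>v. L *v v \<in> cone \<Lambda> \<Longrightarrow> poly_eval F v = poly_eval A v * quad v"
        using vanishing_polynomial_is_multiple_of_quad[OF F] by blast
      then have "F - A * Q \<in> ?I"
        by (simp add: vanishing_ideal_def cone(2) Q(2))
      then have "(F - A * Q) + A * Q \<in> ideal.span (insert Q ?I)"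
        by (intro ideal.span_add ideal.span_scale ideal.span_base) auto
      then show ?thesis by simp
    qed
    then show "vanishing_ideal X \<union> ?I \<subseteq> ideal.span (insert Q ?I)"
      by (auto intro: ideal.span_base)
  qed (rule ideal.subspace_span)
  moreover have "Q \<notin> ?I"
    using quad_q0 by (auto simp: vanishing_ideal_def cone(2) L_q0 Q(2) intro!: bexI[of _ q0])
  ultimately show ?thesis
    using Q(1) cone(1) unfolding quadric_in_def by auto
qed

text \<open>A point over \<open>\<Lambda>\<close> outside \<open>X\<close> is separated from \<open>X\<close> by a form, which is a multiple of \<open>quad\<close> there.\<close>

lemma mem_X_iff: "v \<noteq> 0 \<Longrightarrow> L *v v \<in> cone \<Lambda> \<Longrightarrow> v \<in> cone X \<longleftrightarrow> quad v = 0"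
proof
  assume v: "v \<noteq> 0" "L *v v \<in> cone \<Lambda>" "quad v = 0"
  show "v \<in> cone X"
  proof (rule ccontr)
    assume "v \<notin> cone X"
    then have "point v \<notin> X"
      using v(1) by (simp add: mem_cone_iff)
    then show False
    proof (rule closedin_zariski_separation[OF closed_X])
      fix d F assume F: "form d F" "\<And>w. w \<in> cone X \<Longrightarrow> F w = 0" "point v \<in> nonvanishing F"
      then have "F v = 0"
        using vanishing_form_is_multiple_of_quad[OF F(1,2)] v(2,3) by auto
      then show False
        using F(3) point_in_nonvanishing_iff[OF F(1) v(1)] by simp
    qed
  qed
qed (simp add: quad_def quadratic_relation)

text \<open>The fibre over a point of \<open>\<Lambda>\<close> consists of the roots of a monic quadratic polynomial.\<close>

lemma \<Lambda>_lifts_to_X: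
  assumes "y \<in> cone \<Lambda>" "y \<noteq> 0"
  obtains v where "v \<in> cone X" "v \<noteq> 0" "L *v v = y"
proof -
  have "degree [:\<gamma> y, \<beta> y, 1:] > 0" by simp
  then obtain a where "poly [:\<gamma> y, \<beta> y, 1:] a = 0"
    using alg_closed_imp_poly_has_root by blast
  then have "quad (a *s q0 + B *v y) = 0"
    unfolding quad_combination by (simp add: algebra_simps power2_eq_square)
  moreover have L: "L *v (a *s q0 + B *v y) = y"
    by (rule L_combination)
  moreover have nz: "a *s q0 + B *v y \<noteq> 0"
    using L assms(2) by auto
  ultimately have "a *s q0 + B *v y \<in> cone X"
    using mem_X_iff assms(1) by simp
  with L nz that show thesis by blast
qed

section \<open>The secant locus\<close>

lemma cone_line:
  assumes "v \<noteq> 0"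
  shows "w \<in> cone (linear_span {point q0, point v}) \<longleftrightarrow> (\<exists>a b. w = a *s q0 + b *s (B *v (L *v v)))"
proof -
  let ?y = "B *v (L *v v)"
  let ?S = "vec.span (cone {point q0, point v})"
  have "cone {point q0, point v} = insert 0 (range (\<lambda>c. c *s q0) \<union> range (\<lambda>c. c *s v))"
    using assms q0_nonzero by (simp add: cone_def Rep_point)
  moreover have "insert 0 (range (\<lambda>c. c *s q0) \<union> range (\<lambda>c. c *s v)) \<subseteq> vec.span {q0, v}"
    by (auto intro: vec.span_zero vec.span_scale[OF vec.span_base])
  ultimately have "?S \<subseteq> vec.span {q0, v}"
    by (metis vec.span_minimal vec.subspace_span)
  moreover have "vec.span {q0, v} \<subseteq> ?S"
    using assms q0_nonzero by (intro vec.span_mono) (auto simp: mem_cone_iff)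
  ultimately have S: "?S = vec.span {q0, v}" by blast
  have "w \<in> cone (linear_span {point q0, point v}) \<longleftrightarrow> w \<in> ?S"
  proof (cases "w = 0")
    case False
    have "Rep_pspace (point w) \<subseteq> ?S \<longleftrightarrow> w \<in> ?S"
      using Rep_point_self[OF False] by (auto simp: Rep_point[OF False] vec.span_scale)
    then show ?thesis
      using False by (simp add: mem_cone_iff linear_span_def)
  qed (simp add: vec.span_zero)
  also have "\<dots> \<longleftrightarrow> (\<exists>a b. w = a *s q0 + b *s v)"
    by (auto simp: S vec.span_insert vec.span_singleton algebra_simps)
  also have "\<dots> \<longleftrightarrow> (\<exists>a b. w = a *s q0 + b *s ?y)"
  proof -
    have "a *s q0 + b *s v = (a + b * \<xi> v) *s q0 + b *s ?y" for a b
    proof -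
      have "b *s v = (b * \<xi> v) *s q0 + b *s ?y"
        using arg_cong[OF decomposition[of v], of "\<lambda>w. b *s w"] by (simp add: vec.scale_right_distrib)
      then show ?thesis by (simp add: vec.scale_left_distrib add.assoc)
    qed
    moreover from this[of "a - b * \<xi> v" b for a b]
    have "a *s q0 + b *s ?y = (a - b * \<xi> v) *s q0 + b *s v" for a b
      by simp
    ultimately show ?thesis by metis
  qed
  finally show ?thesis .
qed

lemma line_point_mem:
  assumes "v \<noteq> 0"
  shows "a *s q0 + b *s (B *v (L *v v)) \<in> cone (linear_span {point q0, point v})"
  using cone_line[OF assms] by blast

text \<open>
  On the affine line \<open>a \<mapsto> a q0 + B y\<close> the restrictions of the elements of the ideal are polynomials
  in \<open>a\<close>, and those divisible by \<open>quad\<close> form an ideal which contains both sets of generators.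
\<close>

lemma quad_divides_on_line:
  assumes "v \<noteq> 0" "L *v v \<in> cone \<Lambda>"
    and "F \<in> ideal.span (vanishing_ideal X \<union> vanishing_ideal (linear_span {point q0, point v}))"
  shows "\<exists>P. \<forall>a. poly_eval F (a *s q0 + B *v (L *v v)) =
    poly P a * quad (a *s q0 + B *v (L *v v))"
proof -
  let ?w = "\<lambda>a. a *s q0 + B *v (L *v v)"
  let ?D = "{F. \<exists>P. \<forall>a. poly_eval F (?w a) = poly P a * quad (?w a)}"
  have "ideal.subspace ?D"
    unfolding ideal.subspace_def
  proof (intro conjI ballI allI)
    show "0 \<in> ?D"
      by (auto intro: exI[of _ 0])
  next
    fix F G assume "F \<in> ?D" "G \<in> ?D"
    then obtain P P' where "\<And>a. poly_eval F (?w a) = poly P a * quad (?w a)"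
      "\<And>a. poly_eval G (?w a) = poly P' a * quad (?w a)" by auto
    then have "\<forall>a. poly_eval (F + G) (?w a) = poly (P + P') a * quad (?w a)"
      by (simp only: poly_eval_add poly_add distrib_right simp_thms)
    then show "F + G \<in> ?D" by blast
  next
    fix G F assume "F \<in> ?D"
    then obtain P where P: "\<And>a. poly_eval F (?w a) = poly P a * quad (?w a)" by auto
    obtain R where "\<And>a. poly R a = poly_eval G (?w a)"
      using poly_eval_on_line[of G q0 "B *v (L *v v)"] by blast
    then have "\<forall>a. poly_eval (G * F) (?w a) = poly (R * P) a * quad (?w a)"
      using P by (simp only: poly_eval_mult poly_mult mult.assoc simp_thms)
    then show "G * F \<in> ?D" by blast
  qed
  moreover have "vanishing_ideal X \<subseteq> ?D"
  proof
    fix F assume F: "F \<in> vanishing_ideal X"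
    obtain A where A: "\<And>u. L *v u \<in> cone \<Lambda> \<Longrightarrow> poly_eval F u = poly_eval A u * quad u"
      using vanishing_polynomial_is_multiple_of_quad[OF F] by blast
    obtain P where "\<And>a. poly P a = poly_eval A (?w a)"
      using poly_eval_on_line[of A q0 "B *v (L *v v)"] by blast
    moreover have "L *v ?w a \<in> cone \<Lambda>" for a
      using assms(2) by (simp only: L_combination)
    ultimately have "\<forall>a. poly_eval F (?w a) = poly P a * quad (?w a)"
      using A by simp
    then show "F \<in> ?D" by blast
  qed
  moreover have "vanishing_ideal (linear_span {point q0, point v}) \<subseteq> ?D"
  proof
    fix F assume "F \<in> vanishing_ideal (linear_span {point q0, point v})"
    then have "\<forall>a. poly_eval F (?w a) = poly 0 a * quad (?w a)"
      using line_point_mem[OF assms(1), of _ 1] by (simp add: vanishing_ideal_def)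
    then show "F \<in> ?D" by blast
  qed
  ultimately have "ideal.span (vanishing_ideal X \<union> vanishing_ideal (linear_span {point q0, point v})) \<subseteq> ?D"
    by (intro ideal.span_minimal) auto
  then show ?thesis
    using assms(3) by auto
qed

text \<open>
  With \<open>T\<close> the coordinate on the line that is 1 on \<open>a q0 + B y\<close>, the forms \<open>T\<^sup>d\<close> and \<open>\<xi> T\<^sup>d\<^sup>-\<^sup>1\<close> restrict
  to \<open>1\<close> and \<open>a\<close>, which are independent modulo a monic quadratic polynomial in \<open>a\<close>.
\<close>

lemma secant_over_\<Lambda>:
  assumes v: "v \<noteq> 0" "L *v v \<noteq> 0" "L *v v \<in> cone \<Lambda>"
  shows "2 \<le> scheme_length
    (ideal.span (vanishing_ideal X \<union> vanishing_ideal (linear_span {point q0, point v})))"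
    (is "2 \<le> scheme_length ?J")
proof (rule scheme_length_ge_2)
  fix d :: nat assume "2 \<le> d"
  then obtain e where d: "d = Suc e" by (cases d) auto
  obtain i where i: "(L *v v) $ i \<noteq> 0"
    using v(2) by (metis vec_eq_iff zero_index)
  define T where "T w = (1 / (L *v v) $ i) * (L *v w) $ i" for w
  have T: "form 1 T"
    unfolding T_def by (intro form_cmult form_matrix)
  have T_on_line: "T (a *s q0 + B *v (L *v v)) = 1" for a
    using i by (simp add: T_def L_combination)
  obtain F where F: "homogeneous (int d) F" "\<And>w. poly_eval F w = T w ^ d"
    using form_power[OF T, of d] unfolding form_def by (auto simp: fun_eq_iff)
  have "form (1 + int e * 1) (\<lambda>w. \<xi> w * T w ^ e)"
    by (intro form_mult form_power form_\<xi> T)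
  then obtain G where G: "homogeneous (int d) G" "\<And>w. poly_eval G w = \<xi> w * T w ^ e"
    unfolding form_def by (auto simp: fun_eq_iff d)
  show "2 \<le> hilbert_function ?J d"
  proof (rule hilbert_function_ge_2[OF _ F(1) G(1)])
    have "ideal.subspace ?J"
      by (rule ideal.subspace_span)
    then show "mpoly.subspace ?J"
      by (simp add: ideal.subspace_def mpoly.subspace_def poly_scale_def)
  next
    fix x y assume "poly_scale x F + poly_scale y G \<in> ?J"
    from quad_divides_on_line[OF v(1,3) this] obtain P where
      P: "\<And>a. x + y * a = poly P a * quad (a *s q0 + B *v (L *v v))"
      by (auto simp: F G T_on_line \<xi>_combination)
    define R where "R = [:\<gamma> (L *v v), \<beta> (L *v v), 1:]"
    have "[:x, y:] = P * R"
    proof (rule poly_eqI_alg_closed)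
      fix a
      have "quad (a *s q0 + B *v (L *v v)) = poly R a"
        by (simp add: R_def quad_combination algebra_simps power2_eq_square)
      then show "poly [:x, y:] a = poly (P * R) a"
        using P[of a] by (simp add: mult.commute)
    qed
    moreover have "degree [:x, y:] < degree R"
      by (simp add: R_def)
    ultimately have "P = 0"
      by (metis add_lessD1 degree_mult_eq less_irrefl not_add_less2 mult_eq_0_iff degree_0 gr_implies_not0)
    then show "x = 0 \<and> y = 0"
      using \<open>[:x, y:] = P * R\<close> by simp
  qed
qed

text \<open>This relation determines \<open>\<xi>\<close> on \<open>X\<close> near the fibre over \<open>y\<close>, namely \<open>\<xi> = H / g\<close> where \<open>g \<noteq> 0\<close>.\<close>

lemma linear_relation_outside_\<Lambda>:
  assumes "y \<notin> cone \<Lambda>"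
  obtains g H where "form 1 g" "form 2 H" "g y \<noteq> 0" "\<And>z. z \<in> cone \<Lambda> \<Longrightarrow> g z = 0"
    "\<And>v. v \<in> cone X \<Longrightarrow> g (L *v v) * \<xi> v = H (L *v v)"
proof -
  obtain g where g: "form 1 g" "\<And>z. z \<in> cone \<Lambda> \<Longrightarrow> g z = 0" "g y \<noteq> 0"
    using linear_form_separating[OF linear_subspaceE(1)[OF linear_\<Lambda>] assms] by metis
  moreover obtain H where "form 2 H" "\<And>v. v \<in> cone X \<Longrightarrow> g (L *v v) * \<xi> v = H (L *v v)"
    using conductor_contains[of 2 g] g by auto
  ultimately show thesis using that by blast
qed

text \<open>
  On the line with coordinates \<open>\<xi>\<close> and \<open>T\<close>, the ideal contains a nonzero multiple of \<open>T (\<xi> - \<xi> v T)\<close> by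
  the relation \<open>g \<xi> = H\<close>, and \<open>quad\<close>, which is monic in \<open>\<xi>\<close>. Modulo these two, every form of degree
  \<open>d \<ge> 2\<close> is a multiple of \<open>T\<^sup>d\<close>.
\<close>

lemma no_secant_outside_\<Lambda>:
  assumes v: "v \<in> cone X" "v \<noteq> 0" "L *v v \<notin> cone \<Lambda>"
  shows "\<not> 2 \<le> scheme_length
    (ideal.span (vanishing_ideal X \<union> vanishing_ideal (linear_span {point q0, point v})))"
    (is "\<not> 2 \<le> scheme_length ?J")
proof (rule scheme_length_less_2)
  fix d :: nat assume "2 \<le> d"
  then obtain e where d: "d = Suc (Suc e)"
    by (metis Suc_le_D numeral_2_eq_2 Suc_le_mono)
  define y where "y = L *v v"
  have "y \<noteq> 0"
    using v L_nonzero by (simp add: y_def)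
  then obtain i where i: "y $ i \<noteq> 0"
    by (metis vec_eq_iff zero_index)
  define T where "T w = (1 / y $ i) * (L *v w) $ i" for w
  have T: "form 1 T"
    unfolding T_def by (intro form_cmult form_matrix)
  obtain S where S: "\<And>k. homogeneous (int k) (S k)" "\<And>k w. poly_eval (S k) w = T w ^ k"
    using form_power[OF T] unfolding form_def by (simp add: fun_eq_iff) metis
  obtain g H where gH: "form 1 g" "form 2 H" "g y \<noteq> 0"
    "\<And>v. v \<in> cone X \<Longrightarrow> g (L *v v) * \<xi> v = H (L *v v)"
    using linear_relation_outside_\<Lambda>[OF v(3)] unfolding y_def by metis
  have "form 2 (\<lambda>w. g (L *v w) * \<xi> w - H (L *v w))"
    using form_mult[OF form_compose_matrix[OF gH(1)] form_\<xi>] form_compose_matrix[OF gH(2)]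
    by (intro form_diff) simp_all
  then obtain N where N: "\<And>w. poly_eval N w = g (L *v w) * \<xi> w - H (L *v w)"
    unfolding form_def by (auto simp: fun_eq_iff)
  have N_mem: "N \<in> vanishing_ideal X"
    using gH(4) by (simp add: vanishing_ideal_def N)
  obtain Q where Q: "\<And>w. poly_eval Q w = quad w"
    using form_quad unfolding form_def by metis
  have Q_mem: "Q \<in> vanishing_ideal X"
    using quadratic_relation by (simp add: vanishing_ideal_def Q quad_def)
  show "hilbert_function ?J d \<le> 1"
  proof (rule hilbert_function_le_1[OF S(1)])
    fix F :: "('n, 'k) mpoly"
    assume "homogeneous (int d) F"
    then have "form (int d) (poly_eval F)"
      by (rule form_poly_eval)
    then obtain A G' H' where AGH: "form (int d - 2) A" "form (int d - 1) G'" "form (int d) H'"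
      "\<And>w. poly_eval F w = A w * quad w + G' (L *v w) * \<xi> w + H' (L *v w)"
      using division_by_quad by blast
    obtain A' where A': "\<And>w. poly_eval A' w = A w"
      using AGH(1) unfolding form_def by metis
    \<comment> \<open>the value of \<open>F\<close> at the point \<open>v\<close> of \<open>X\<close>, where \<open>T = 1\<close> and \<open>quad = 0\<close>\<close>
    define c where "c = G' y * \<xi> v + H' y"
    define M where "M = poly_scale (G' y / g y) (S e)"
    define R where "R = F - poly_scale c (S d) - A' * Q - M * N"
    have "R \<in> vanishing_ideal (linear_span {point q0, point v})"
      unfolding vanishing_ideal_def
    proof (intro CollectI ballI)
      fix w assume "w \<in> cone (linear_span {point q0, point v})"
      then obtain a b where "w = a *s q0 + b *s (B *v y)"
        using cone_line[OF v(2)] unfolding y_def by blast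
      then have w: "w = a *s q0 + B *v (b *s y)"
        by (simp add: vector_scalar_commute)
      have val: "L *v w = b *s y" "\<xi> w = a" "T w = b"
        using i by (simp_all add: w L_combination \<xi>_combination T_def)
      have Hy: "H y = g y * \<xi> v"
        using gH(4)[OF v(1)] by (simp add: y_def)
      have forms: "g (b *s y) = b * g y" "H (b *s y) = b ^ 2 * (g y * \<xi> v)"
        "G' (b *s y) = b ^ Suc e * G' y" "H' (b *s y) = b ^ Suc (Suc e) * H' y"
        using form_scaling[OF gH(1), of b y] form_scaling[OF gH(2), of b y] Hy
          form_scaling[OF AGH(2), of b y] form_scaling[OF AGH(3), of b y]
        by (simp_all add: d nat_add_distrib)
      have identity: "(b * t) * G * a + (b * (b * t)) * H - (G * x + H) * (b * (b * t))
          - (G / u * t) * (b * u * a - b ^ 2 * (u * x)) = 0" if "u \<noteq> 0" for t G H x u :: 'k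
      proof -
        define k where "k = G / u"
        then have "G = k * u"
          using that by simp
        then show ?thesis
          unfolding k_def[symmetric] by algebra
      qed
      have "poly_eval R w = (b * b ^ e) * G' y * a + (b * (b * b ^ e)) * H' y
          - (G' y * \<xi> v + H' y) * (b * (b * b ^ e))
          - (G' y / g y * b ^ e) * (b * g y * a - b ^ 2 * (g y * \<xi> v))"
        by (simp add: R_def M_def AGH(4) A' Q N S(2) val c_def forms d)
      then show "poly_eval R w = 0"
        using identity[OF gH(3)] by simp
    qed
    then have "R + (A' * Q + M * N) \<in> ?J"
      using N_mem Q_mem by (intro ideal.span_add ideal.span_scale ideal.span_base) auto
    then have "F - poly_scale c (S d) \<in> ?J"
      by (simp add: R_def algebra_simps)
    then show "\<exists>c. F - poly_scale c (S d) \<in> ?J" by blast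
  qed
qed

lemma secant_locus_iff:
  assumes "v \<in> cone X" "v \<noteq> 0"
  shows "point v \<in> secant_locus (point q0) X \<longleftrightarrow> L *v v \<in> cone \<Lambda>"
proof -
  have "point v \<in> X"
    using assms by (simp add: mem_cone_iff)
  then show ?thesis
    using secant_over_\<Lambda>[OF assms(2) L_nonzero[OF assms]] no_secant_outside_\<Lambda>[OF assms]
    unfolding secant_locus_def by blast
qed

lemma image_secant_locus: "proj_map L ` secant_locus (point q0) X = \<Lambda>"
proof (intro set_eqI iffI)
  fix y assume "y \<in> proj_map L ` secant_locus (point q0) X"
  then obtain x where x: "x \<in> secant_locus (point q0) X" "y = proj_map L x" by blast
  obtain v where v: "v \<noteq> 0" "x = point v" using point_exhaust .
  have "v \<in> cone X"
    using x v by (simp add: mem_cone_iff secant_locus_def)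
  then show "y \<in> \<Lambda>"
    using secant_locus_iff[of v] v x L_nonzero[of v]
    by (simp add: proj_map_point flip: mem_cone_iff[of "L *v v"])
next
  fix y assume y: "y \<in> \<Lambda>"
  obtain w where w: "w \<noteq> 0" "y = point w" using point_exhaust .
  obtain v where v: "v \<in> cone X" "v \<noteq> 0" "L *v v = w"
    using \<Lambda>_lifts_to_X[of w] w(1) y mem_cone_iff[OF w(1)] unfolding w(2) by metis
  then have "point v \<in> secant_locus (point q0) X"
    using secant_locus_iff[of v] w y by (simp add: mem_cone_iff)
  moreover have "proj_map L (point v) = y"
    using v w by (simp add: proj_map_point)
  ultimately show "y \<in> proj_map L ` secant_locus (point q0) X" by blast
qed

section \<open>The singular locus of the projection\<close>

lemma proj_map_on_X: "v \<noteq> 0 \<Longrightarrow> point v \<in> X \<Longrightarrow> L *v v \<noteq> 0 \<and> proj_map L (point v) = point (L *v v)"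
  using L_nonzero[of v] by (simp add: mem_cone_iff proj_map_point)

lemma morphism_proj_map: "Y \<subseteq> X \<Longrightarrow> proj_map L ` Y \<subseteq> Z \<Longrightarrow> morphism_of_varieties Y Z (proj_map L)"
  by (rule morphism_of_forms[where \<Phi> = "(*v) L" and e = 1]) (use form_matrix proj_map_on_X in blast)+

lemma lift_to_cone_X:
  assumes "w \<noteq> 0" "point w \<in> proj_map L ` X"
  obtains v where "v \<noteq> 0" "v \<in> cone X" "L *v v = w"
proof -
  obtain x where x: "x \<in> X" "point w = proj_map L x"
    using assms(2) by blast
  obtain u where u: "u \<noteq> 0" "x = point u" using point_exhaust .
  then have Lu: "L *v u \<noteq> 0" "point w = point (L *v u)"
    using proj_map_on_X[of u] x by auto
  then have "w \<in> Rep_pspace (point (L *v u))"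
    using Rep_point_self[OF assms(1)] by simp
  then obtain c where "w = c *s (L *v u)"
    using Lu(1) by (auto simp: Rep_point)
  then have c: "w = L *v (c *s u)"
    by (simp add: L_scale)
  moreover have "c *s u \<in> cone X"
    using u x by (simp add: cone_scale mem_cone_iff)
  moreover have "c *s u \<noteq> 0"
    using c assms(1) by auto
  ultimately show thesis using that by blast
qed

text \<open>
  Where \<open>g \<noteq> 0\<close>, a point \<open>w\<close> of the image comes from the point with \<open>\<xi> = H w / g w\<close>; clearing the
  denominator gives the inverse \<open>\<Phi> w = H w q0 + g w B w\<close>, whose components are quadratic forms.
\<close>

lemma isomorphism_outside_\<Lambda>:
  assumes "y \<notin> cone \<Lambda>"
  obtains U where "openin zariski U" "point y \<in> U"
    "isomorphism_of_varieties (X \<inter> proj_map L -` U) (proj_map L ` X \<inter> U) (proj_map L)"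
proof -
  have "y \<noteq> 0"
    using assms by auto
  obtain g H where gH: "form 1 g" "form 2 H" "g y \<noteq> 0"
    "\<And>v. v \<in> cone X \<Longrightarrow> g (L *v v) * \<xi> v = H (L *v v)"
    using linear_relation_outside_\<Lambda>[OF assms] by metis
  define U where "U = nonvanishing g"
  have U: "point w \<in> U \<longleftrightarrow> g w \<noteq> 0" if "w \<noteq> 0" for w
    unfolding U_def by (rule point_in_nonvanishing_iff[OF gH(1) that])
  define \<Phi> where "\<Phi> w = H w *s q0 + g w *s (B *v w)" for w
  have form_\<Phi>: "form 2 (\<lambda>w. \<Phi> w $ i)" for i
  proof -
    have "form 2 (\<lambda>w. q0 $ i * H w)"
      using gH(2) by (rule form_cmult)
    moreover have "form (1 + 1) (\<lambda>w. g w * (B *v w) $ i)"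
      using gH(1) form_matrix by (rule form_mult)
    ultimately show ?thesis
      using form_add by (fastforce simp: \<Phi>_def mult.commute)
  qed
  have \<Phi>: "\<Phi> (L *v v) = g (L *v v) *s v" if "v \<in> cone X" for v
  proof -
    have "g (L *v v) *s v = (g (L *v v) * \<xi> v) *s q0 + g (L *v v) *s (B *v (L *v v))"
      using arg_cong[OF decomposition[of v], of "\<lambda>w. g (L *v v) *s w"]
      by (simp add: vec.scale_right_distrib)
    then show ?thesis
      using gH(4)[OF that] by (simp add: \<Phi>_def)
  qed
  obtain h where h: "\<And>w. w \<noteq> 0 \<Longrightarrow> h (point w) = point (\<Phi> w)"
    using map_of_forms[of 2 \<Phi>] form_\<Phi> by metis
  have inverse: "h (point (L *v v)) = point v"
    if "v \<noteq> 0" "v \<in> cone X" "point (L *v v) \<in> U" for v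
    using h[of "L *v v"] U[of "L *v v"] that L_nonzero[of v] \<Phi>[of v] by (simp add: point_scale)
  let ?Y = "X \<inter> proj_map L -` U" and ?Z = "proj_map L ` X \<inter> U"
  have over: "\<Phi> w \<noteq> 0 \<and> h (point w) \<in> ?Y \<and> proj_map L (h (point w)) = point w"
    if w: "w \<noteq> 0" "point w \<in> ?Z" for w
  proof -
    obtain v where v: "v \<noteq> 0" "v \<in> cone X" "L *v v = w"
      using lift_to_cone_X[of w] w by blast
    then have "h (point w) = point v" "point v \<in> X" "proj_map L (point v) = point w"
      using inverse[of v] w proj_map_on_X[of v] by (auto simp: mem_cone_iff)
    moreover have "\<Phi> w \<noteq> 0"
      using \<Phi>[of v] v U w by auto
    ultimately show ?thesis
      using w by simp
  qed
  have "isomorphism_of_varieties ?Y ?Z (proj_map L)"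
    unfolding isomorphism_of_varieties_def
  proof (intro conjI exI ballI)
    show "morphism_of_varieties ?Y ?Z (proj_map L)"
      by (rule morphism_proj_map) auto
    show "morphism_of_varieties ?Z ?Y h"
    proof (rule morphism_of_forms[where \<Phi> = \<Phi> and e = 2])
      show "h ` ?Z \<subseteq> ?Y"
      proof
        fix x assume "x \<in> h ` ?Z"
        then obtain z where z: "z \<in> ?Z" "x = h z" by blast
        obtain w where "w \<noteq> 0" "z = point w" using point_exhaust .
        then show "x \<in> ?Y"
          using over z by blast
      qed
    qed (use form_\<Phi> over h in blast)+
  next
    fix x assume x: "x \<in> ?Y"
    obtain v where v: "v \<noteq> 0" "x = point v" using point_exhaust .
    then show "h (proj_map L x) = x"
      using inverse[of v] x proj_map_on_X[of v] by (simp add: mem_cone_iff)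
  next
    fix z assume z: "z \<in> ?Z"
    obtain w where "w \<noteq> 0" "z = point w" using point_exhaust .
    then show "proj_map L (h z) = z"
      using over z by blast
  qed
  moreover have "point y \<in> U"
    using U[OF \<open>y \<noteq> 0\<close>] gH(3) by simp
  moreover have "openin zariski U"
    unfolding U_def using gH(1) by (rule openin_nonvanishing)
  ultimately show thesis using that by blast
qed

text \<open>
  If the projection is an isomorphism over \<open>U\<close>, every function upstairs over an open set \<open>V \<subseteq> U\<close>
  comes from below through the inverse, so that \<open>\<sigma> V\<close> is zero. But \<open>\<sigma>\<close> is locally surjective onto
  \<open>\<O>\<^sub>\<Lambda>(-1)\<close>, which has the section \<open>1 / w\<^sub>i\<close> near \<open>y\<close>.
\<close>

lemma not_isomorphism_on_\<Lambda>:
  assumes seq: "structure_sheaf_sequence L X \<Lambda>"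
    and y: "y \<in> \<Lambda>" and U: "openin zariski U" "y \<in> U"
    and iso: "isomorphism_of_varieties (X \<inter> proj_map L -` U) (proj_map L ` X \<inter> U) (proj_map L)"
  shows False
proof -
  let ?\<pi> = "proj_map L"
  let ?Y = "X \<inter> ?\<pi> -` U" and ?Z = "?\<pi> ` X \<inter> U"
  obtain \<sigma> where \<sigma>: "sheaf_short_exact zariski
          (\<lambda>U. regular (proj_map L ` X \<inter> U)) restr
          (\<lambda>U. regular (X \<inter> proj_map L -` U)) (\<lambda>V. restr (proj_map L -` V))
          (\<lambda>U. twist_sections (-1) (\<Lambda> \<inter> U)) restr_cone
          (\<lambda>U s. restr X (s \<circ> proj_map L)) \<sigma>"
    using seq unfolding structure_sheaf_sequence_def by blast
  have kernel: "\<sigma> V s = 0" if "openin zariski V" "s \<in> regular (X \<inter> ?\<pi> -` V)"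
    "restr (?\<pi> -` V) s \<in> (\<lambda>s. restr X (s \<circ> ?\<pi>)) ` regular (?\<pi> ` X \<inter> V)" for V s
    using \<sigma> that unfolding sheaf_short_exact_def by blast
  have surjective: "\<exists>V. openin zariski V \<and> z \<in> V \<and> V \<subseteq> W \<and>
      restr_cone V t \<in> \<sigma> V ` regular (X \<inter> ?\<pi> -` V)"
    if "openin zariski W" "t \<in> twist_sections (-1) (\<Lambda> \<inter> W)" "z \<in> W" for W t z
    using \<sigma> that unfolding sheaf_short_exact_def by blast
  obtain h where h: "morphism_of_varieties ?Z ?Y h" "\<And>x. x \<in> ?Y \<Longrightarrow> h (?\<pi> x) = x"
    "\<And>z. z \<in> ?Z \<Longrightarrow> ?\<pi> (h z) = z"
    and \<pi>: "morphism_of_varieties ?Y ?Z ?\<pi>"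
    using iso unfolding isomorphism_of_varieties_def by blast
  have h_in: "h z \<in> ?Y" if "z \<in> ?Z" for z
    using h(1) that unfolding morphism_of_varieties_def continuous_map_def by auto
  have zero: "\<sigma> V s = 0" if V: "openin zariski V" "V \<subseteq> U" and s: "s \<in> regular (X \<inter> ?\<pi> -` V)" for V s
  proof (rule kernel[OF V(1) s])
    \<comment> \<open>\<open>proj_map L\<close> is arbitrary at the centre, so only the trace on \<open>X\<close> of the preimage of \<open>V\<close> is open\<close>
    have "openin (subtopology zariski ?Z) (V \<inter> ?Z)"
      using V(1) by (auto simp: openin_subtopology)
    then have "openin (subtopology zariski ?Y) {x \<in> topspace (subtopology zariski ?Y). ?\<pi> x \<in> V \<inter> ?Z}"
      using \<pi> unfolding morphism_of_varieties_def continuous_map_def by blast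
    then obtain W where W: "openin zariski W" "{x \<in> topspace (subtopology zariski ?Y). ?\<pi> x \<in> V \<inter> ?Z} = W \<inter> ?Y"
      by (auto simp: openin_subtopology)
    have W_iff: "x \<in> W \<longleftrightarrow> ?\<pi> x \<in> V" if "x \<in> ?Y" for x
      using W(2) that by auto
    have "X \<inter> ?\<pi> -` V = ?Y \<inter> W"
      using W_iff V(2) by blast
    then have "restr (?Z \<inter> h -` W) (s \<circ> h) \<in> regular (?Z \<inter> h -` W)"
      using h(1) W(1) s unfolding morphism_of_varieties_def by metis
    moreover have "?Z \<inter> h -` W = ?\<pi> ` X \<inter> V"
      using W_iff[OF h_in] h(3) V(2) by auto
    ultimately have "restr (?\<pi> ` X \<inter> V) (s \<circ> h) \<in> regular (?\<pi> ` X \<inter> V)"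
      by simp
    moreover have "restr (?\<pi> -` V) s = restr X (restr (?\<pi> ` X \<inter> V) (s \<circ> h) \<circ> ?\<pi>)"
    proof
      fix x
      have "s x = 0" if "x \<notin> X \<inter> ?\<pi> -` V"
        using s that unfolding regular_iff by blast
      then show "restr (?\<pi> -` V) s x = restr X (restr (?\<pi> ` X \<inter> V) (s \<circ> h) \<circ> ?\<pi>) x"
        using h(2)[of x] V(2) by (auto simp: restr_def)
    qed
    ultimately show "restr (?\<pi> -` V) s \<in> (\<lambda>s. restr X (s \<circ> ?\<pi>)) ` regular (?\<pi> ` X \<inter> V)"
      by blast
  qed
  obtain w where w: "w \<noteq> 0" "y = point w" using point_exhaust .
  then obtain i where i: "w $ i \<noteq> 0"
    by (metis vec_eq_iff zero_index)
  define W where "W = U \<inter> nonvanishing (\<lambda>v :: 'k^'m. v $ i)"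
  define t where "t = restr_cone (\<Lambda> \<inter> W) (\<lambda>v. 1 / v $ i)"
  have "openin zariski W"
    unfolding W_def using U(1) openin_nonvanishing[OF form_coordinate] by (rule openin_Int)
  moreover have "t \<in> twist_sections (-1) (\<Lambda> \<inter> W)"
    unfolding t_def by (rule inverse_coordinate_in_twist_sections[of _ i]) (auto simp: W_def)
  moreover have yW: "y \<in> W"
    unfolding W_def w(2) using U(2) i w(2) point_in_nonvanishing_iff[OF form_coordinate w(1), of i]
    by simp
  ultimately obtain V s where V: "openin zariski V" "y \<in> V" "V \<subseteq> W"
    and s: "s \<in> regular (X \<inter> ?\<pi> -` V)" "restr_cone V t = \<sigma> V s"
    using surjective[of W t y] by blast
  have "restr_cone V t = 0"
    using zero[OF V(1) _ s(1)] V(3) s(2) by (auto simp: W_def)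
  then have "restr_cone V t w = 0" by simp
  moreover have "w \<in> cone V" "w \<in> cone (\<Lambda> \<inter> W)"
    using w(2) V(2) yW y by (simp_all add: mem_cone_iff[OF w(1)])
  ultimately show False
    using w(1) i by (simp add: t_def restr_cone_def restr_def)
qed

lemma sing_locus_eq:
  assumes "structure_sheaf_sequence L X \<Lambda>"
  shows "sing_locus L X = \<Lambda>"
proof (intro set_eqI iffI)
  fix y assume y: "y \<in> sing_locus L X"
  obtain w where w: "w \<noteq> 0" "y = point w" using point_exhaust .
  show "y \<in> \<Lambda>"
  proof (rule ccontr)
    assume "y \<notin> \<Lambda>"
    then have "w \<notin> cone \<Lambda>"
      using w by (simp add: mem_cone_iff)
    then show False
    proof (rule isomorphism_outside_\<Lambda>)
      fix U assume "openin zariski U" "point w \<in> U"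
        "isomorphism_of_varieties (X \<inter> proj_map L -` U) (proj_map L ` X \<inter> U) (proj_map L)"
      then show False
        using y unfolding sing_locus_def w(2) by auto
    qed
  qed
next
  fix y assume y: "y \<in> \<Lambda>"
  then have "y \<in> proj_map L ` X"
    using image_secant_locus by (auto simp: secant_locus_def)
  then show "y \<in> sing_locus L X"
    using not_isomorphism_on_\<Lambda>[OF assms y] unfolding sing_locus_def by blast
qed

section \<open>Birationality\<close>

text \<open>
  Here \<open>\<Lambda>\<close> is the whole target, so \<open>X\<close> is the hypersurface \<open>quad = 0\<close> and a form vanishing on \<open>X\<close> is
  a multiple \<open>A quad\<close>. If it vanishes on a larger irreducible set \<open>C\<close>, then \<open>quad\<close> does not vanish on
  \<open>C\<close>, hence \<open>A\<close> does, and its degree is smaller by 2.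
\<close>

lemma form_vanishing_beyond_hypersurface_X:
  assumes all: "\<And>y. y \<in> cone \<Lambda>"
    and C: "irreducible_closed zariski C" "X \<subset> C"
    and F: "form d F" "\<And>v. v \<in> cone C \<Longrightarrow> F v = 0"
  shows "F v = 0"
  using F
proof (induction "nat d" arbitrary: d F v rule: less_induct)
  case less
  show ?case
  proof (cases "d < 0")
    case True
    then show ?thesis using form_negative[OF less.prems(1)] by simp
  next
    case False
    have "cone X \<subseteq> cone C"
      using C(2) by (auto simp: cone_def)
    then obtain A where A: "form (d - 2) A" "\<And>v. F v = A v * quad v"
      using vanishing_form_is_multiple_of_quad[OF less.prems(1)] less.prems(2) all by blast
    have "C \<subseteq> - nonvanishing A \<union> - nonvanishing quad"
    proof
      fix x assume x: "x \<in> C"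
      obtain u where u: "u \<noteq> 0" "x = point u" using point_exhaust .
      then have "A u * quad u = 0"
        using less.prems(2)[of u] A(2)[of u] x by (simp add: mem_cone_iff)
      then show "x \<in> - nonvanishing A \<union> - nonvanishing quad"
        using u point_in_nonvanishing_iff[OF A(1) u(1)] point_in_nonvanishing_iff[OF form_quad u(1)]
        by auto
    qed
    then consider "C \<subseteq> - nonvanishing A" | "C \<subseteq> - nonvanishing quad"
      using C(1) closedin_vanishing[OF A(1)] closedin_vanishing[OF form_quad]
      unfolding irreducible_closed_def by blast
    then show ?thesis
    proof cases
      case 1
      have "A u = 0" if "u \<in> cone C" "u \<noteq> 0" for u
        using 1 that point_in_nonvanishing_iff[OF A(1) that(2)] by (auto simp: mem_cone_iff)
      moreover have "A 0 = 0"
      proof -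
        obtain x where "x \<in> C" using C(2) by blast
        then obtain u where u: "u \<noteq> 0" "u \<in> cone C"
          by (metis mem_cone_iff point_exhaust)
        then have "A u = 0"
          using calculation by blast
        consider "d - 2 = 0" | "0 < d - 2" | "d - 2 < 0" by linarith
        then show ?thesis
          using \<open>A u = 0\<close> form_degree_0[OF A(1), of 0 u] form_at_0[OF A(1)] form_negative[OF A(1)]
          by cases auto
      qed
      ultimately have "A u = 0" if "u \<in> cone C" for u
        using that by blast
      moreover have "nat (d - 2) < nat d \<or> d = 0"
        using False by linarith
      ultimately have "A v = 0"
        using less.hyps[of "d - 2" A v] A(1) form_negative[OF A(1)] by auto
      then show ?thesis using A(2) by simp
    next
      case 2
      have "C \<subseteq> X"
      proof
        fix x assume x: "x \<in> C"
        obtain u where u: "u \<noteq> 0" "x = point u" using point_exhaust .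
        then have "quad u = 0"
          using 2 x point_in_nonvanishing_iff[OF form_quad u(1)] by auto
        then show "x \<in> X"
          using mem_X_iff[OF u(1) all] u by (simp add: mem_cone_iff)
      qed
      then show ?thesis using C(2) by blast
    qed
  qed
qed

text \<open>
  Otherwise the second member of a chain \<open>X \<subset> C 1 \<subset> C 2\<close> would, by the preceding lemma, lie on no
  hypersurface; but it is closed and not the whole space.
\<close>

lemma X_not_over_\<Lambda>:
  assumes "nondegenerate X" "codimension zariski X \<ge> 2"
  obtains v where "v \<noteq> 0" "v \<in> cone X" "L *v v \<notin> cone \<Lambda>"
proof (rule ccontr)
  assume "\<not> thesis"
  then have over: "L *v v \<in> cone \<Lambda>" if "v \<in> cone X" for v
    using that zero_in_cone by (cases "v = 0") (use \<open>\<And>v. v \<noteq> 0 \<Longrightarrow> v \<in> cone X \<Longrightarrow> L *v v \<notin> cone \<Lambda> \<Longrightarrow> thesis\<close> in auto)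
  have "X \<subseteq> cone_over L \<Lambda>"
    using over Rep_pspace_subset_cone by (fastforce simp: cone_over_def)
  then have "cone_over L \<Lambda> = UNIV"
    using assms(1) cone_cone_over(1)[OF linear_\<Lambda>] unfolding nondegenerate_def by blast
  then have "B *v y \<in> cone (cone_over L \<Lambda>)" for y
    by (cases "B *v y = 0") (simp_all add: mem_cone_iff)
  then have all: "y \<in> cone \<Lambda>" for y
    using cone_cone_over(2)[OF linear_\<Lambda>, of "B *v y"] by (simp add: L_B)
  obtain n C where n: "2 \<le> n" and C: "C 0 = X" "\<And>i. i \<le> n \<Longrightarrow> irreducible_closed zariski (C i)"
    "\<And>i. i < n \<Longrightarrow> C i \<subset> C (Suc i)"
  proof -
    have "\<not> codimension zariski X \<le> 1"
    proof
      assume "codimension zariski X \<le> 1"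
      then have "(2 :: enat) \<le> 1"
        using assms(2) by (rule order_trans[rotated])
      then show False by simp
    qed
    then obtain n where "n \<in> {n. \<exists>C. C 0 = X \<and> (\<forall>i\<le>n. irreducible_closed zariski (C i)) \<and>
        (\<forall>i<n. C i \<subset> C (Suc i))}" "\<not> enat n \<le> 1"
      unfolding codimension_def by (meson SUP_least)
    then show thesis
      using that by (force simp: one_enat_def not_le)
  qed
  have sub: "X \<subset> C 1" "C 1 \<subset> C 2"
    using C(3)[of 0] C(3)[of 1] n by (auto simp: C(1) numeral_2_eq_2)
  then obtain p where "p \<notin> C 1" by blast
  have closed: "closedin zariski (C 1)" and irreducible: "irreducible_closed zariski (C 1)"
    using C(2)[of 1] n by (auto simp: irreducible_closed_def)
  obtain d F where F: "form d F" "\<And>v. v \<in> cone (C 1) \<Longrightarrow> F v = 0" "p \<in> nonvanishing F"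
    using closedin_zariski_separation[OF closed \<open>p \<notin> C 1\<close>] by metis
  have "F v = 0" for v
    using form_vanishing_beyond_hypersurface_X[OF all irreducible sub(1) F(1,2)] .
  then show False
    using F(3) by (simp add: nonvanishing_def)
qed

lemma birational_proj_map:
  assumes "nondegenerate X" "codimension zariski X \<ge> 2"
  shows "birational_morphism X (proj_map L ` X) (proj_map L)"
proof -
  obtain v where v: "v \<noteq> 0" "v \<in> cone X" "L *v v \<notin> cone \<Lambda>"
    using X_not_over_\<Lambda>[OF assms] .
  obtain U where U: "openin zariski U" "point (L *v v) \<in> U"
    "isomorphism_of_varieties (X \<inter> proj_map L -` U) (proj_map L ` X \<inter> U) (proj_map L)"
    using isomorphism_outside_\<Lambda>[OF v(3)] .
  have morphism: "morphism_of_varieties X (proj_map L ` X) (proj_map L)"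
    by (rule morphism_proj_map) auto
  have open_image: "openin (subtopology zariski (proj_map L ` X)) (proj_map L ` X \<inter> U)"
    using U(1) by (auto simp: openin_subtopology)
  then have "openin (subtopology zariski X) {x \<in> topspace (subtopology zariski X). proj_map L x \<in> proj_map L ` X \<inter> U}"
    using morphism unfolding morphism_of_varieties_def continuous_map_def by blast
  moreover have "{x \<in> topspace (subtopology zariski X). proj_map L x \<in> proj_map L ` X \<inter> U} = X \<inter> proj_map L -` U"
    by auto
  ultimately have open_preimage: "openin (subtopology zariski X) (X \<inter> proj_map L -` U)"
    by simp
  have "point v \<in> X \<inter> proj_map L -` U"
    using v U(2) proj_map_on_X[of v] by (simp add: mem_cone_iff)
  then have nonempty: "X \<inter> proj_map L -` U \<noteq> {}" "proj_map L ` X \<inter> U \<noteq> {}"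
    by auto
  show ?thesis
    unfolding birational_morphism_def
    using morphism open_preimage open_image nonempty U(3)
    by (intro conjI exI[of _ "X \<inter> proj_map L -` U"] exI[of _ "proj_map L ` X \<inter> U"])
qed

end

section \<open>From the exact sequence to the quadric relation\<close>

lemma split_projection_exists:
  fixes L :: "'k::alg_closed_field^'n::finite^'m::finite"
  assumes "linear_projection_from q L"
  obtains q0 B \<xi> where "split_projection L q0 B \<xi>" "q = point q0"
proof -
  obtain q0 where q0: "q0 \<noteq> 0" "q = point q0" using point_exhaust .
  have surj: "surj ((*v) L)" and ker: "L *v v = 0 \<longleftrightarrow> v \<in> Rep_pspace q" for v
    using assms unfolding linear_projection_from_def by blast+
  obtain B where B: "L ** B = mat 1"
    using surj unfolding matrix_right_invertible_surjective[symmetric] by blast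
  have LB: "L *v (B *v y) = y" for y
    by (simp add: matrix_vector_mul_assoc B)
  obtain i where i: "q0 $ i \<noteq> 0"
    using q0(1) by (metis vec_eq_iff zero_index)
  define \<xi> where "\<xi> v = (1 / q0 $ i) * (v $ i - (B *v (L *v v)) $ i)" for v
  have "split_projection L q0 B \<xi>"
  proof
    show "L *v q0 = 0"
      using ker Rep_point_self[OF q0(1)] q0(2) by simp
    show "v = \<xi> v *s q0 + B *v (L *v v)" for v
    proof -
      have "L *v (v - B *v (L *v v)) = 0"
        by (simp add: matrix_vector_mult_diff_distrib LB)
      then obtain c where c: "v - B *v (L *v v) = c *s q0"
        using ker q0 by (auto simp: Rep_point)
      then have "(v - B *v (L *v v)) $ i = c * q0 $ i"
        by simp
      then have "\<xi> v = c"
        using i by (simp add: \<xi>_def)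
      then show ?thesis
        using c by (simp add: algebra_simps)
    qed
    show "form 1 \<xi>"
      unfolding \<xi>_def by (intro form_cmult form_diff form_coordinate form_compose_matrix form_matrix)
  qed (use q0(1) LB in auto)
  with q0(2) that show thesis by blast
qed

text \<open>
  The map \<open>\<rho>\<close> sends \<open>\<xi>\<close> to a constant \<open>c\<close>, which is not zero as otherwise \<open>X\<close> would lie in a
  hyperplane \<open>\<xi> = H \<circ> L\<close>. By linearity it sends \<open>(G \<circ> L) \<xi>\<close> to \<open>c G\<close>, and its kernel consists of the
  forms pulled back from the target. The quadratic relation comes from comparing the image \<open>G\<close> of
  \<open>\<xi>\<^sup>2\<close> with that of \<open>(1/c) (G \<circ> L) \<xi>\<close>.
\<close>

lemma (in split_projection) conductor_data_exists:
  fixes X :: "('k, 'n) pspace set" and \<Lambda> :: "('k, 'm) pspace set"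
  assumes closed: "closedin zariski X" and nondeg: "nondegenerate X"
    and center: "linear_projection_from (point q0) L" "point q0 \<notin> X"
    and \<Lambda>: "linear_subspace \<Lambda>" and seq: "coordinate_ring_sequence L X \<Lambda>"
  obtains \<beta> \<gamma> where "conductor_data L q0 B \<xi> X \<Lambda> \<beta> \<gamma>"
proof -
  obtain \<rho> where
    add: "\<And>j s t. s \<in> twist_sections j X \<Longrightarrow> t \<in> twist_sections j X \<Longrightarrow> \<rho> j (s + t) = \<rho> j s + \<rho> j t"
    and linear: "\<And>j d G s. homogeneous d G \<Longrightarrow> s \<in> twist_sections j X \<Longrightarrow>
        \<rho> (d + j) ((\<lambda>v. poly_eval G (L *v v)) * s) = poly_eval G * \<rho> j s"
    and kernel: "\<And>j. projection_pullback L X ` coordinate_ring (proj_map L ` X) j =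
          {s \<in> twist_sections j X. \<rho> j s = 0}"
    and image: "\<And>j. \<rho> j ` twist_sections j X = coordinate_ring \<Lambda> (j - 1)"
  proof -
    from seq obtain \<rho> where "(\<forall>j. \<forall>s\<in>twist_sections j X. \<forall>t\<in>twist_sections j X. \<rho> j (s + t) = \<rho> j s + \<rho> j t) \<and>
       (\<forall>j d G. homogeneous d G \<longrightarrow> (\<forall>s\<in>twist_sections j X.
          \<rho> (d + j) ((\<lambda>v. poly_eval G (L *v v)) * s) = poly_eval G * \<rho> j s)) \<and>
       (\<forall>j. inj_on (projection_pullback L X) (coordinate_ring (proj_map L ` X) j)) \<and>
       (\<forall>j. projection_pullback L X ` coordinate_ring (proj_map L ` X) j =
            {s \<in> twist_sections j X. \<rho> j s = 0}) \<and>
       (\<forall>j. \<rho> j ` twist_sections j X = coordinate_ring \<Lambda> (j - 1))"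
      unfolding coordinate_ring_sequence_def by (elim exE)
    then show thesis by (elim conjE) (rule that[of \<rho>]; blast)
  qed
  define E where "E = restr_cone X"
  have E_val: "E F v = F v" if "v \<in> cone X" "v \<noteq> 0" for F v
    using that by (simp add: E_def restr_cone_def restr_def)
  have E_eqI: "E F = E F'" if "\<And>v. v \<in> cone X \<Longrightarrow> F v = F' v" for F F'
    using that by (auto simp: E_def restr_cone_def restr_def)
  have E_mem: "E F \<in> twist_sections j X" if "form j F" for j F
    unfolding E_def using that by (rule restr_cone_form_in_twist_sections)
  have L_nonzero: "L *v v \<noteq> 0" if "v \<in> cone X" "v \<noteq> 0" for v
  proof
    assume "L *v v = 0"
    then have "v \<in> Rep_pspace (point q0)"
      using center(1) unfolding linear_projection_from_def by blast
    then have "point v = point q0"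
      using q0_nonzero that(2) by (intro mem_Rep_point)
    then show False
      using that center(2) by (simp add: mem_cone_iff)
  qed
  have pullback: "projection_pullback L X (\<lambda>y. if y \<in> cone (proj_map L ` X) then H y else 0) =
      E (\<lambda>v. H (L *v v))" for H
  proof -
    have "L *v v \<in> cone (proj_map L ` X)" if "v \<in> cone X" "v \<noteq> 0" for v
    proof -
      have "point (L *v v) = proj_map L (point v)" "point v \<in> X"
        using L_nonzero[OF that] that by (simp_all add: proj_map_point flip: mem_cone_iff)
      then show ?thesis
        using L_nonzero[OF that] by (simp add: mem_cone_iff)
    qed
    then show ?thesis
      by (intro ext) (simp add: E_def projection_pullback_def restr_cone_def restr_def)
  qed
  have kernel_of_pullback: "\<rho> j (E (\<lambda>v. H (L *v v))) = 0" if "form j H" for j H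
  proof -
    have "(\<lambda>y. if y \<in> cone (proj_map L ` X) then H y else 0) \<in> coordinate_ring (proj_map L ` X) j"
      using that unfolding coordinate_ring_def form_def by blast
    then have "projection_pullback L X (\<lambda>y. if y \<in> cone (proj_map L ` X) then H y else 0) \<in>
        {s \<in> twist_sections j X. \<rho> j s = 0}"
      unfolding kernel[symmetric] by (rule imageI)
    then show ?thesis
      unfolding pullback by simp
  qed
  have pullback_of_kernel: "\<exists>H. form j H \<and> E F = E (\<lambda>v. H (L *v v))"
    if F: "form j F" "\<rho> j (E F) = 0" for j F
  proof -
    have "E F \<in> projection_pullback L X ` coordinate_ring (proj_map L ` X) j"
      unfolding kernel using F E_mem by blast
    then obtain H where "homogeneous j H"
      "E F = projection_pullback L X (\<lambda>y. if y \<in> cone (proj_map L ` X) then poly_eval H y else 0)"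
      unfolding coordinate_ring_def by blast
    then show ?thesis
      using pullback form_poly_eval by metis
  qed
  obtain F0 where F0: "form 0 F0" "\<rho> 1 (E \<xi>) = (\<lambda>y. if y \<in> cone \<Lambda> then F0 y else 0)"
  proof -
    have "\<rho> 1 (E \<xi>) \<in> coordinate_ring \<Lambda> 0"
      using image[of 1] E_mem[OF form_\<xi>] by auto
    then show thesis
      using that form_poly_eval unfolding coordinate_ring_def by blast
  qed
  define c where "c = F0 0"
  have "F0 y = c" for y
    unfolding c_def using form_degree_0[OF F0(1) refl] .
  then have \<rho>_\<xi>: "\<rho> 1 (E \<xi>) = (\<lambda>y. if y \<in> cone \<Lambda> then c else 0)"
    by (simp add: F0(2) cong: if_cong)
  have c_nonzero: "c \<noteq> 0"
  proof
    assume "c = 0"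
    then have "\<rho> 1 (E \<xi>) = 0"
      by (simp add: \<rho>_\<xi> fun_eq_iff)
    then obtain H where H: "form 1 H" "E \<xi> = E (\<lambda>v. H (L *v v))"
      using pullback_of_kernel form_\<xi> by blast
    define W where "W = {v. \<xi> v = H (L *v v)}"
    have "vec.subspace W"
      unfolding W_def vec.subspace_def
      using form_at_0[OF form_\<xi>] form_at_0[OF H(1)] form_scaling[OF form_\<xi>] form_scaling[OF H(1)]
        form_1_additive[OF form_\<xi> refl] form_1_additive[OF H(1) refl]
      by (simp add: matrix_vector_right_distrib L_scale)
    moreover have cone_W: "v \<in> W" if "v \<in> cone X" for v
    proof (cases "v = 0")
      case True
      then show ?thesis
        using \<open>vec.subspace W\<close> by (simp add: vec.subspace_0)
    next
      case False
      then show ?thesis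
        using fun_cong[OF H(2), of v] that by (simp add: E_val W_def)
    qed
    then have "X \<subseteq> {p. Rep_pspace p \<subseteq> W}"
      using Rep_pspace_subset_cone by blast
    ultimately have "{p. Rep_pspace p \<subseteq> W} = UNIV"
      using nondeg unfolding nondegenerate_def linear_subspace_def by blast
    then have "q0 \<in> W"
      using Rep_point_self[OF q0_nonzero] by blast
    then show False
      using form_at_0[OF H(1)] by (simp add: W_def \<xi>_q0 L_q0)
  qed
  have \<rho>_multiple: "\<rho> (d + 1) (E (\<lambda>v. G (L *v v) * \<xi> v)) = (\<lambda>y. if y \<in> cone \<Lambda> then G y * c else 0)"
    if G: "form d G" for d G
  proof -
    obtain G' where G': "homogeneous d G'" "G = poly_eval G'"
      using G unfolding form_def by blast
    have "E (\<lambda>v. G (L *v v) * \<xi> v) = (\<lambda>v. poly_eval G' (L *v v)) * E \<xi>"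
      by (auto simp: E_def G'(2) restr_cone_def restr_def)
    then show ?thesis
      using linear[OF G'(1) E_mem[OF form_\<xi>]] by (auto simp: \<rho>_\<xi> G'(2))
  qed
  have form_multiple: "form (d + 1) (\<lambda>v. G (L *v v) * \<xi> v)" if "form d G" for d G
    using that form_\<xi> by (intro form_mult form_compose_matrix)
  have vanishes: "G y = 0" if "form (d - 1) G" "form d H"
    "\<And>v. v \<in> cone X \<Longrightarrow> G (L *v v) * \<xi> v + H (L *v v) = 0" "y \<in> cone \<Lambda>" for d G H y
  proof -
    have "E (\<lambda>v. G (L *v v) * \<xi> v) = E (\<lambda>v. - H (L *v v))"
      by (rule E_eqI) (use that(3) in \<open>simp add: eq_neg_iff_add_eq_0\<close>)
    then have "\<rho> d (E (\<lambda>v. G (L *v v) * \<xi> v)) = 0"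
      using kernel_of_pullback[OF form_uminus[OF that(2)]] by simp
    then show ?thesis
      using fun_cong[OF \<rho>_multiple[OF that(1)], of y] that(4) c_nonzero by simp
  qed
  have contains: "\<exists>H. form d H \<and> (\<forall>v\<in>cone X. G (L *v v) * \<xi> v = H (L *v v))"
    if G: "form (d - 1) G" "\<And>y. y \<in> cone \<Lambda> \<Longrightarrow> G y = 0" for d G
  proof (cases "d \<le> 0")
    case True
    then have "G = (\<lambda>y. 0)"
      using form_negative[OF G(1)] by simp
    then show ?thesis
      using form_0 by (intro exI[of _ "\<lambda>y. 0"]) simp
  next
    case False
    have "\<rho> d (E (\<lambda>v. G (L *v v) * \<xi> v)) = 0"
      using \<rho>_multiple[OF G(1)] G(2) by (auto simp: fun_eq_iff)
    then obtain H where H: "form d H" "E (\<lambda>v. G (L *v v) * \<xi> v) = E (\<lambda>v. H (L *v v))"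
      using pullback_of_kernel[of d] form_multiple[OF G(1)] by auto
    have "G (L *v v) * \<xi> v = H (L *v v)" if "v \<in> cone X" for v
    proof (cases "v = 0")
      case True
      then show ?thesis
        using form_at_0[OF form_\<xi>] form_at_0[OF H(1)] False by simp
    next
      case False
      then show ?thesis
        using fun_cong[OF H(2), of v] that by (simp add: E_val)
    qed
    then show ?thesis using H(1) by blast
  qed
  obtain G where G: "form 1 G" "\<rho> 2 (E (\<lambda>v. \<xi> v ^ 2)) = (\<lambda>y. if y \<in> cone \<Lambda> then G y else 0)"
  proof -
    have "form 2 (\<lambda>v. \<xi> v ^ 2)"
      using form_power[OF form_\<xi>, of 2] by simp
    then have "\<rho> 2 (E (\<lambda>v. \<xi> v ^ 2)) \<in> coordinate_ring \<Lambda> 1"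
      using image[of 2] E_mem by auto
    then show thesis
      using that form_poly_eval unfolding coordinate_ring_def by blast
  qed
  define \<beta> where "\<beta> y = - (1 / c) * G y" for y
  have form_\<beta>: "form 1 \<beta>"
    unfolding \<beta>_def using G(1) by (rule form_cmult)
  have forms: "form 2 (\<lambda>v. \<xi> v ^ 2)" "form 2 (\<lambda>v. \<beta> (L *v v) * \<xi> v)"
    using form_power[OF form_\<xi>, of 2] form_multiple[OF form_\<beta>] by simp_all
  have "E (\<lambda>v. \<xi> v ^ 2 + \<beta> (L *v v) * \<xi> v) = E (\<lambda>v. \<xi> v ^ 2) + E (\<lambda>v. \<beta> (L *v v) * \<xi> v)"
    by (auto simp: E_def restr_cone_def restr_def)
  then have "\<rho> 2 (E (\<lambda>v. \<xi> v ^ 2 + \<beta> (L *v v) * \<xi> v)) =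
      \<rho> 2 (E (\<lambda>v. \<xi> v ^ 2)) + \<rho> 2 (E (\<lambda>v. \<beta> (L *v v) * \<xi> v))"
    using add[OF E_mem[OF forms(1)] E_mem[OF forms(2)]] by (simp only:)
  also have "\<rho> 2 (E (\<lambda>v. \<beta> (L *v v) * \<xi> v)) = (\<lambda>y. if y \<in> cone \<Lambda> then \<beta> y * c else 0)"
    using \<rho>_multiple[OF form_\<beta>] by (simp only: one_add_one)
  also have "\<rho> 2 (E (\<lambda>v. \<xi> v ^ 2)) + \<dots> = 0"
    using c_nonzero by (simp add: G(2) \<beta>_def fun_eq_iff)
  finally have "\<rho> 2 (E (\<lambda>v. \<xi> v ^ 2 + \<beta> (L *v v) * \<xi> v)) = 0" .
  then obtain H where H: "form 2 H" "E (\<lambda>v. \<xi> v ^ 2 + \<beta> (L *v v) * \<xi> v) = E (\<lambda>v. H (L *v v))"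
    using pullback_of_kernel form_add[OF forms] by blast
  have relation: "\<xi> v ^ 2 + \<beta> (L *v v) * \<xi> v + - H (L *v v) = 0" if "v \<in> cone X" for v
  proof (cases "v = 0")
    case True
    then show ?thesis
      using form_at_0[OF form_\<xi>] form_at_0[OF H(1)] by simp
  next
    case False
    then show ?thesis
      using fun_cong[OF H(2), of v] that by (simp add: E_val)
  qed
  have "conductor_data L q0 B \<xi> X \<Lambda> \<beta> (\<lambda>y. - H y)"
    by unfold_locales
      (fact closed L_nonzero \<Lambda> form_\<beta> form_uminus[OF H(1)] relation vanishes contains)+
  then show thesis using that by blast
qed

theorem corollary3p2:
  fixes X :: "('k::alg_closed_field, 'n::finite) pspace set"
    and q :: "('k, 'n) pspace"
    and L :: "'k^'n^'m::finite"
    and \<Lambda> :: "('k, 'm) pspace set"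
    and p :: nat
  assumes "irreducible_closed zariski X"
    and "nondegenerate X"
    and "codimension zariski X \<ge> 2"
    and "p \<ge> 2" and "property_N p X"
    and "q \<notin> X"
    and "linear_projection_from q L"
    and "secant_locus q X \<noteq> {}"
    and "linear_subspace \<Lambda>"
    and "coordinate_ring_sequence L X \<Lambda>"
    and "structure_sheaf_sequence L X \<Lambda>"
  shows "quadric_in (cone_over L \<Lambda>) (secant_scheme_ideal L X) \<and>
    \<Lambda> = sing_locus L X \<and>
    proj_map L ` secant_locus q X = sing_locus L X \<and>
    birational_morphism X (proj_map L ` X) (proj_map L)"
proof -
  obtain q0 B \<xi> where split: "split_projection L q0 B \<xi>" and q: "q = point q0"
    using split_projection_exists[OF assms(7)] .
  have "closedin zariski X"
    using assms(1) by (simp add: irreducible_closed_def)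
  then obtain \<beta> \<gamma> where "conductor_data L q0 B \<xi> X \<Lambda> \<beta> \<gamma>"
    using split_projection.conductor_data_exists[OF split] assms unfolding q by metis
  then interpret conductor_data L q0 B \<xi> X \<Lambda> \<beta> \<gamma> .
  have "sing_locus L X = \<Lambda>"
    using assms(11) by (rule sing_locus_eq)
  then show ?thesis
    using quadric_in_cone_over image_secant_locus birational_proj_map[OF assms(2,3)]
    by (simp add: secant_scheme_ideal_def q)
qed

end
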